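(* Let $J_5$ be the 3-graph on vertex set $[6]$ whose edges are all triples $\{x,y,6\}$ with $\{x,y\}\subseteq[5]$, $x\neq y$, and let $F_{3,2}=([5],\{123,124,125,345\})$. Then \[\pi(J_5, F_{3,2}) = \frac{3}{8}.\]
   Context: A 3-graph $G=(V,E)$ consists of a vertex set $V$ and a set $E$ of 3-element subsets of $V$ (edges); $xyz$ abbreviates $\{x,y,z\}$. For a family $\mathcal{F}$ of 3-graphs, $G$ is $\mathcal{F}$-free if it contains no member of $\mathcal{F}$ as a (not necessarily induced) subgraph. $\mathrm{ex}(n,\mathcal{F})$ is the maximum number of edges of an $\mathcal{F}$-free 3-graph on $n$ vertices, and the Turán density is $\pi(\mathcal{F})=\lim_{n\to\infty}\mathrm{ex}(n,\mathcal{F})/\binom{n}{3}$ (this limit exists). $\pi(H_1,\dots,H_k)$ means $\pi(\{H_1,\dots,H_k\})$. *)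

theory Defs
  imports Complex_Main
begin

type_synonym 'a hypergraph = "'a set \<times> 'a set set"

abbreviation verts :: "'a hypergraph \<Rightarrow> 'a set" where
  "verts G \<equiv> fst G"

abbreviation edges :: "'a hypergraph \<Rightarrow> 'a set set" where
  "edges G \<equiv> snd G"

definition three_graph :: "'a hypergraph \<Rightarrow> bool" where
  "three_graph G \<longleftrightarrow> (\<forall>e\<in>edges G. e \<subseteq> verts G \<and> card e = 3)"

text \<open>\<open>G\<close> has a (not necessarily induced) subgraph isomorphic to \<open>H\<close>;
  the copy is the image of \<open>H\<close> under the injection.\<close>

definition contains_copy :: "'a hypergraph \<Rightarrow> 'b hypergraph \<Rightarrow> bool" where
  "contains_copy G H \<longleftrightarrow>
     (\<exists>f. inj_on f (verts H) \<and> f ` verts H \<subseteq> verts G \<and> (\<forall>e\<in>edges H. f ` e \<in> edges G))"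

definition family_free :: "'b hypergraph set \<Rightarrow> 'a hypergraph \<Rightarrow> bool" where
  "family_free \<F> G \<longleftrightarrow> (\<forall>H\<in>\<F>. \<not> contains_copy G H)"

text \<open>Every finite 3-graph is isomorphic to one whose vertices are natural numbers, so
  the host graphs may be taken over \<open>nat\<close>. The set of edge counts is finite
  (\<open>finite_edge_counts\<close>), and it is nonempty when every member of \<open>\<F>\<close> has an edge
  (\<open>edge_counts_nonempty\<close>), so \<open>Max\<close> is then a genuine maximum.\<close>

definition edge_counts :: "nat \<Rightarrow> 'b hypergraph set \<Rightarrow> nat set" where
  "edge_counts n \<F> = {card (edges G) | G :: nat hypergraph.
     three_graph G \<and> finite (verts G) \<and> card (verts G) = n \<and> family_free \<F> G}"

definition ex :: "nat \<Rightarrow> 'b hypergraph set \<Rightarrow> nat" where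
  "ex n \<F> = Max (edge_counts n \<F>)"

text \<open>The limit exists for every family whose members all have an edge; see
  \<open>turan_density_LIMSEQ\<close> below.\<close>

definition turan_density :: "'b hypergraph set \<Rightarrow> real" where
  "turan_density \<F> = lim (\<lambda>n. real (ex n \<F>) / real (n choose 3))"

definition J5 :: "nat hypergraph" where
  "J5 = ({1..6}, {{x, y, 6} | x y. {x, y} \<subseteq> {1..5} \<and> x \<noteq> y})"

definition F32 :: "nat hypergraph" where
  "F32 = ({1..5}, {{1, 2, 3}, {1, 2, 4}, {1, 2, 5}, {3, 4, 5}})"

lemma three_graph_J5: "three_graph J5"
  by (auto simp: three_graph_def J5_def)

lemma three_graph_F32: "three_graph F32"
  by (auto simp: three_graph_def F32_def)

lemma J5_edges_nonempty: "edges J5 \<noteq> {}"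
proof -
  have "{1, 2, 6} \<in> edges J5"
    unfolding J5_def snd_conv mem_Collect_eq
    by (rule exI[of _ 1], rule exI[of _ 2]) auto
  then show ?thesis by blast
qed

lemma F32_edges_nonempty: "edges F32 \<noteq> {}"
  by (simp add: F32_def)

lemma three_graph_card_edges_le:
  assumes "three_graph G" "finite (verts G)"
  shows "finite (edges G)" "card (edges G) \<le> card (verts G) choose 3"
proof -
  have sub: "edges G \<subseteq> {e. e \<subseteq> verts G \<and> card e = 3}"
    using assms(1) by (auto simp: three_graph_def)
  have fin: "finite {e. e \<subseteq> verts G \<and> card e = 3}"
    using assms(2) by simp
  show "finite (edges G)"
    using sub fin by (rule finite_subset)
  show "card (edges G) \<le> card (verts G) choose 3"
    using card_mono[OF fin sub] n_subsets[OF assms(2)] by simp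
qed

lemma finite_edge_counts: "finite (edge_counts n \<F>)"
proof (rule finite_subset)
  show "edge_counts n \<F> \<subseteq> {..n choose 3}"
    using three_graph_card_edges_le(2) by (auto simp: edge_counts_def)
qed simp

lemma edge_counts_nonempty:
  assumes "\<forall>H\<in>\<F>. edges H \<noteq> {}"
  shows "edge_counts n \<F> \<noteq> {}"
proof -
  let ?G = "({..<n}, {}) :: nat hypergraph"
  have "family_free \<F> ?G"
    using assms by (fastforce simp: family_free_def contains_copy_def)
  then have "card (edges ?G) \<in> edge_counts n \<F>"
    unfolding edge_counts_def
    by (intro CollectI exI[of _ ?G]) (simp add: three_graph_def)
  then show ?thesis by blast
qed

lemma card_edges_le_ex:
  fixes G :: "nat hypergraph"
  assumes "three_graph G" "finite (verts G)" "family_free \<F> G"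
  shows "card (edges G) \<le> ex (card (verts G)) \<F>"
  unfolding ex_def
  by (rule Max_ge[OF finite_edge_counts]) (use assms in \<open>unfold edge_counts_def, blast\<close>)

lemma ex_attained:
  assumes "\<forall>H\<in>\<F>. edges H \<noteq> {}"
  obtains G :: "nat hypergraph" where "three_graph G" "finite (verts G)" "card (verts G) = n"
    "family_free \<F> G" "card (edges G) = ex n \<F>"
proof -
  have "ex n \<F> \<in> edge_counts n \<F>"
    unfolding ex_def by (rule Max_in[OF finite_edge_counts edge_counts_nonempty[OF assms]])
  then show ?thesis using that by (auto simp: edge_counts_def)
qed

lemma ex_Suc_le:
  assumes "\<forall>H\<in>\<F>. edges H \<noteq> {}"
  shows "(n - 2) * ex (Suc n) \<F> \<le> Suc n * ex n \<F>"
proof -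
  obtain G :: "nat hypergraph" where G: "three_graph G" "finite (verts G)"
    "card (verts G) = Suc n" "family_free \<F> G" "card (edges G) = ex (Suc n) \<F>"
    using ex_attained[OF assms] by blast
  define del where "del v = (verts G - {v}, {e \<in> edges G. v \<notin> e})" for v
  have finE: "finite (edges G)" using three_graph_card_edges_le(1)[OF G(1,2)] .
  have le: "card {e \<in> edges G. v \<notin> e} \<le> ex n \<F>" if v: "v \<in> verts G" for v
  proof -
    have 1: "three_graph (del v)" using G(1) by (auto simp: three_graph_def del_def)
    have 2: "family_free \<F> (del v)"
      using G(4) by (fastforce simp: family_free_def contains_copy_def del_def)
    have 3: "finite (verts (del v))" "card (verts (del v)) = n"
      using G(2,3) v by (auto simp: del_def)
    show ?thesis using card_edges_le_ex[OF 1 3(1) 2] 3(2) by (simp add: del_def)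
  qed
  have "(n - 2) * card (edges G) = (\<Sum>e\<in>edges G. card {v \<in> verts G. v \<notin> e})"
  proof -
    have "card {v \<in> verts G. v \<notin> e} = n - 2" if "e \<in> edges G" for e
    proof -
      have e: "e \<subseteq> verts G" "card e = 3" using G(1) that by (auto simp: three_graph_def)
      have "{v \<in> verts G. v \<notin> e} = verts G - e" by auto
      then show ?thesis
        using e G(2,3) by (simp add: card_Diff_subset finite_subset)
    qed
    then show ?thesis by (simp add: mult.commute)
  qed
  also have "\<dots> = (\<Sum>v\<in>verts G. card {e \<in> edges G. v \<notin> e})"
    using sum.swap_restrict[OF finE G(2), of "\<lambda>_ _. 1 :: nat" "\<lambda>e v. v \<notin> e"] by simp
  also have "\<dots> \<le> (\<Sum>v\<in>verts G. ex n \<F>)"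
    by (rule sum_mono) (rule le)
  finally show ?thesis using G(3,5) by simp
qed

lemma ex_ratio_Suc_le:
  assumes "\<forall>H\<in>\<F>. edges H \<noteq> {}" and n: "n \<ge> 3"
  shows "real (ex (Suc n) \<F>) / real (Suc n choose 3) \<le> real (ex n \<F>) / real (n choose 3)"
proof -
  have pos: "real (n choose 3) > 0" "real (Suc n choose 3) > 0" "real (n - 2) > 0"
    using n by (auto simp: zero_less_binomial_iff)
  have bin: "(n - 2) * (Suc n choose 3) = Suc n * (n choose 3)"
    using binomial_absorb_comp[of "Suc n" 3] n by (simp add: numeral_3_eq_3 numeral_2_eq_2)
  have "real (n - 2) * (real (ex (Suc n) \<F>) * real (n choose 3))
      = real ((n - 2) * ex (Suc n) \<F>) * real (n choose 3)" by simp
  also have "\<dots> \<le> real (Suc n * ex n \<F>) * real (n choose 3)"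
    using ex_Suc_le[OF assms(1), of n] by (intro mult_right_mono) (simp_all only: of_nat_le_iff of_nat_0_le_iff)
  also have "\<dots> = real (ex n \<F>) * real (Suc n * (n choose 3))"
    by (simp only: of_nat_mult ac_simps)
  also have "\<dots> = real (n - 2) * (real (ex n \<F>) * real (Suc n choose 3))"
    unfolding bin[symmetric] by simp
  finally have "real (ex (Suc n) \<F>) * real (n choose 3) \<le> real (ex n \<F>) * real (Suc n choose 3)"
    using pos(3) by (simp only: mult_le_cancel_left_pos)
  then show ?thesis
    using pos by (simp add: field_simps)
qed

lemma turan_density_LIMSEQ:
  assumes "\<forall>H\<in>\<F>. edges H \<noteq> {}"
  shows "(\<lambda>n. real (ex n \<F>) / real (n choose 3)) \<longlonglongrightarrow> turan_density \<F>"
proof -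
  let ?r = "\<lambda>n. real (ex n \<F>) / real (n choose 3)"
  have "decseq (\<lambda>n. ?r (n + 3))"
    by (rule decseq_SucI) (use ex_ratio_Suc_le[OF assms] in \<open>simp only: add_Suc le_add2\<close>)
  then obtain L where "(\<lambda>n. ?r (n + 3)) \<longlonglongrightarrow> L"
    by (rule decseq_convergent[where B = 0]) auto
  then have "?r \<longlonglongrightarrow> L" by (rule LIMSEQ_offset)
  then show ?thesis unfolding turan_density_def by (simp add: limI)
qed

end

(*
  Both J5 and F32 cover every pair of their vertices by an edge, so composing with an arbitrary map of six points
  into a free 3-graph G yields again a free 3-graph, and one can work with homomorphism densities of G itself
  instead of passing to a limit.

  Upper bound: the flag algebra argument on six vertices. For every free 3-graph H on six vertices, 3/8 minus its
  edge density is at least an average, over the labellings of H, of products of two linear forms. Averaged over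
  all maps of six points into G, these products become sums of squares, hence 6 |E| <= (3/8) n^3. The forms belong
  to pairs of vertices, to quadruples spanning two edges, and to quadruples spanning three edges. That the
  inequality holds for every H is a finite computation.

  Lower bound: the balanced blow-up of the complete 3-graph on four vertices. There every link is tripartite, and
  the common neighbourhood of two vertices contains no edge.
*)
theory Submission
  imports Defs "HOL-Library.FuncSet" "HOL-Combinatorics.Permutations" "HOL-Real_Asymp.Real_Asymp"
begin

section \<open>The blow-up of the complete 3-graph on four vertices\<close>

text \<open>There are 2^20 labelled 3-graphs on six vertices, too many to evaluate
  \<open>deficit\<close> on each of them by rewriting; this obstacle shapes the upper bound. The
  products of forms are summed over whole orbits of labellings, and the forms are separated into
  even and odd ones under the symmetries of their root. Hence \<open>deficit\<close> is invariant
  under all permutations of the six vertices, and only graphs in a normal form have to be searched.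

  The common factor in \<open>deficit\<close> is 20 * 30958682112 = 619173642240, and 3/8 of it is
  the constant term 232190115840. There is no slack: the balanced blow-up attains 16 |E| = n^3
  whenever 4 divides n, so every 3-graph on six points that arises from a map into it must have
  deficit exactly 0. This is why the rounded forms have to vanish on average there.

  \<open>J5\<close> enters in one place only: among the \<open>F32\<close>-free 3-graphs on six
  vertices it excludes just \<open>J5\<close> itself, whose edge density is 1/2.\<close>

lemma triple_eq_iff:
  assumes "p \<noteq> q" "q \<noteq> r" "p \<noteq> r"
  shows "{x, y, z} = {p, q, r} \<longleftrightarrow>
    (x, y, z) \<in> {(p, q, r), (p, r, q), (q, p, r), (q, r, p), (r, p, q), (r, q, p)}"
proof
  assume eq: "{x, y, z} = {p, q, r}"
  have "x \<in> {p, q, r}" "y \<in> {p, q, r}" "z \<in> {p, q, r}"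
    "p \<in> {x, y, z}" "q \<in> {x, y, z}" "r \<in> {x, y, z}"
    using eq by blast+
  then show "(x, y, z) \<in> {(p, q, r), (p, r, q), (q, p, r), (q, r, p), (r, p, q), (r, q, p)}"
    using assms by auto
qed auto

lemma card_ordered_triples_of_set:
  assumes "card e = 3"
  shows "card {(x, y, z). {x, y, z} = e} = 6"
proof -
  obtain p q r where e: "e = {p, q, r}" "p \<noteq> q" "q \<noteq> r" "p \<noteq> r"
    using assms by (auto simp: card_3_iff)
  have "{(x, y, z). {x, y, z} = e} =
      {(p, q, r), (p, r, q), (q, p, r), (q, r, p), (r, p, q), (r, q, p)}"
    unfolding e(1) triple_eq_iff[OF e(2-4)] by auto
  then show ?thesis using e by simp
qed

text \<open>Both bounds count edges through their six orderings: the lower bound for the blow-up,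
  the upper bound for the sum over three vertices in \<open>triple_density_le\<close>.\<close>

lemma card_ordered_triples:
  assumes "finite E" and "\<And>e. e \<in> E \<Longrightarrow> card e = 3"
  shows "card {(x, y, z). {x, y, z} \<in> E} = 6 * card E"
proof -
  let ?T = "\<lambda>e. {(x, y, z). {x, y, z} = e}"
  have "{(x, y, z). {x, y, z} \<in> E} = (\<Union>e\<in>E. ?T e)" by auto
  also have "card \<dots> = (\<Sum>e\<in>E. card (?T e))"
  proof (rule card_UN_disjoint)
    show "\<forall>e\<in>E. finite (?T e)"
    proof
      fix e assume "e \<in> E"
      then have "card (?T e) = 6" using assms(2) card_ordered_triples_of_set by blast
      then show "finite (?T e)" using card.infinite by fastforce
    qed
  qed (use assms in auto)
  also have "\<dots> = 6 * card E"
    using assms(2) by (simp add: card_ordered_triples_of_set)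
  finally show ?thesis .
qed

text \<open>The classes are the residues modulo 4, so for every n their sizes differ by at most
  one.\<close>

definition K4_blowup :: "nat \<Rightarrow> nat hypergraph" where
  "K4_blowup n = ({..<n}, {{x, y, z} | x y z. x < n \<and> y < n \<and> z < n \<and>
     x mod 4 \<noteq> y mod 4 \<and> x mod 4 \<noteq> z mod 4 \<and> y mod 4 \<noteq> z mod 4})"

lemma three_graph_K4_blowup: "three_graph (K4_blowup n)"
  unfolding three_graph_def K4_blowup_def by (force simp: card_3_iff)

text \<open>The set comprehension only provides some enumeration p, q, r of the edge. The condition
  is symmetric in the three vertices, so it carries over to x, y, z.\<close>

lemma K4_blowup_edge_iff:
  "{x, y, z} \<in> edges (K4_blowup n) \<longleftrightarrow> x < n \<and> y < n \<and> z < n \<and>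
     x mod 4 \<noteq> y mod 4 \<and> x mod 4 \<noteq> z mod 4 \<and> y mod 4 \<noteq> z mod 4"
proof
  assume "{x, y, z} \<in> edges (K4_blowup n)"
  then obtain p q r where eq: "{x, y, z} = {p, q, r}" and p: "p < n" "q < n" "r < n"
    "p mod 4 \<noteq> q mod 4" "p mod 4 \<noteq> r mod 4" "q mod 4 \<noteq> r mod 4"
    unfolding K4_blowup_def by auto
  then have "p \<noteq> q" "p \<noteq> r" "q \<noteq> r" by auto
  then have "(x, y, z) \<in> {(p, q, r), (p, r, q), (q, p, r), (q, r, p), (r, p, q), (r, q, p)}"
    using eq triple_eq_iff by metis
  then show "x < n \<and> y < n \<and> z < n \<and>
     x mod 4 \<noteq> y mod 4 \<and> x mod 4 \<noteq> z mod 4 \<and> y mod 4 \<noteq> z mod 4"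
    using p by auto
qed (auto simp: K4_blowup_def)

lemma no_five_distinct_residues:
  fixes a b c d e :: nat
  assumes "distinct [a mod 4, b mod 4, c mod 4, d mod 4, e mod 4]"
  shows False
proof -
  have "card (set [a mod 4, b mod 4, c mod 4, d mod 4, e mod 4]) \<le> card {..<4::nat}"
    by (rule card_mono) auto
  then show False
    using distinct_card[OF assms] by simp
qed

text \<open>Two vertices of a common edge lie in different classes. In \<open>F32\<close>, and among
  the vertices 1, ..., 5 of \<open>J5\<close>, any two of five vertices lie in a common edge, so a
  copy would need five classes.\<close>

lemma family_free_K4_blowup: "family_free {J5, F32} (K4_blowup n)"
proof -
  have "False" if c: "contains_copy (K4_blowup n) J5"
  proof -
    obtain f :: "nat \<Rightarrow> nat" where f: "\<forall>e\<in>edges J5. f ` e \<in> edges (K4_blowup n)"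
      using c unfolding contains_copy_def by blast
    have ne: "f x mod 4 \<noteq> f y mod 4 \<and> f x mod 4 \<noteq> f 6 mod 4"
      if "x \<in> {1..5}" "y \<in> {1..5}" "x \<noteq> y" for x y
    proof -
      have "{x, y, 6} \<in> edges J5" using that unfolding J5_def by auto
      then have "{f x, f y, f 6} \<in> edges (K4_blowup n)" using f by force
      then show ?thesis unfolding K4_blowup_edge_iff by simp
    qed
    have "distinct [f 1 mod 4, f 2 mod 4, f 3 mod 4, f 4 mod 4, f 5 mod 4]"
      using ne[of 1 2] ne[of 1 3] ne[of 1 4] ne[of 1 5] ne[of 2 3] ne[of 2 4] ne[of 2 5]
        ne[of 3 4] ne[of 3 5] ne[of 4 5] by auto
    then show False by (rule no_five_distinct_residues)
  qed
  moreover have "False" if c: "contains_copy (K4_blowup n) F32"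
  proof -
    obtain f :: "nat \<Rightarrow> nat" where f: "\<forall>e\<in>edges F32. f ` e \<in> edges (K4_blowup n)"
      using c unfolding contains_copy_def by blast
    have "{f 1, f 2, f 3} \<in> edges (K4_blowup n)" "{f 1, f 2, f 4} \<in> edges (K4_blowup n)"
      "{f 1, f 2, f 5} \<in> edges (K4_blowup n)" "{f 3, f 4, f 5} \<in> edges (K4_blowup n)"
      using f unfolding F32_def by simp_all
    then have "distinct [f 1 mod 4, f 2 mod 4, f 3 mod 4, f 4 mod 4, f 5 mod 4]"
      unfolding K4_blowup_edge_iff by auto
    then show False by (rule no_five_distinct_residues)
  qed
  ultimately show ?thesis unfolding family_free_def by blast
qed

text \<open>There are 24 ordered choices of three different residues a, b, c, and each residue has
  at least m = n div 4 representatives 4 * i + a below n. This gives 24 m^3 ordered triples, six for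
  every edge.\<close>

lemma card_edges_K4_blowup: "4 * (n div 4) ^ 3 \<le> card (edges (K4_blowup n))"
proof -
  define m where "m = n div 4"
  let ?D = "{(a, b, c). a < (4::nat) \<and> b < 4 \<and> c < 4 \<and> a \<noteq> b \<and> a \<noteq> c \<and>
    b \<noteq> c}"
  let ?T = "{(x, y, z). {x, y, z} \<in> edges (K4_blowup n)}"
  let ?g = "\<lambda>((a, b, c), i, j, k). (4 * i + a, 4 * j + b, 4 * k + c :: nat)"
  have D: "?D = set [(a, b, c). a \<leftarrow> [0..<4], b \<leftarrow> [0..<4], c \<leftarrow> [0..<4], a
    \<noteq> b \<and> a \<noteq> c \<and> b \<noteq> c]"
    by auto
  have cD: "card ?D = 24"
    unfolding D by (simp add: upt_rec)
  have fin: "finite (edges (K4_blowup n))"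
    by (rule three_graph_card_edges_le(1)[OF three_graph_K4_blowup]) (simp add: K4_blowup_def)
  have cT: "card ?T = 6 * card (edges (K4_blowup n))"
    by (rule card_ordered_triples[OF fin]) (use three_graph_K4_blowup in \<open>auto simp: three_graph_def\<close>)
  have "?T \<subseteq> {..<n} \<times> {..<n} \<times> {..<n}"
    unfolding K4_blowup_edge_iff by auto
  then have "finite ?T"
    by (rule finite_subset) simp
  moreover have "?g ` (?D \<times> {..<m} \<times> {..<m} \<times> {..<m}) \<subseteq> ?T"
    unfolding K4_blowup_edge_iff m_def by auto
  moreover have "inj_on ?g (?D \<times> {..<m} \<times> {..<m} \<times> {..<m})"
  proof -
    have "i = i' \<and> a = a'" if "4 * i + a = 4 * i' + a'" "a < 4" "a' < 4" for i i' a a' :: nat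
      using that by presburger
    then show ?thesis unfolding inj_on_def by fast
  qed
  ultimately have "card (?D \<times> {..<m} \<times> {..<m} \<times> {..<m}) \<le> card ?T"
    by (meson card_inj_on_le)
  then show ?thesis
    unfolding card_cartesian_product cD cT m_def by (simp add: power3_eq_cube)
qed

section \<open>From edge counts to the Turan density\<close>

lemma members_have_edges: "\<forall>H\<in>{J5, F32}. edges H \<noteq> {}"
  using J5_edges_nonempty F32_edges_nonempty by blast

lemma real_choose_3:
  assumes "n \<ge> 3"
  shows "6 * real (n choose 3) = real n * (real n - 1) * (real n - 2)"
  using assms by (auto simp: binomial_gbinomial gbinomial_prod_rev numeral_3_eq_3 field_simps)

lemma turan_density_J5_F32_ge: "turan_density {J5, F32} \<ge> 3 / 8"
proof (rule LIMSEQ_le)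
  \<comment> \<open>Since n div 4 is at least (n - 3) / 4, six times the edge number is at least 24
    ((n - 3) / 4)^3 = (3/8) (n - 3)^3.\<close>
  let ?l = "\<lambda>n. 3 / 8 * (real n - 3) ^ 3 / (real n * (real n - 1) * (real n - 2))"
  show "?l \<longlonglongrightarrow> 3 / 8" by real_asymp
  show "(\<lambda>n. real (ex n {J5, F32}) / real (n choose 3)) \<longlonglongrightarrow> turan_density {J5,
    F32}"
    by (rule turan_density_LIMSEQ[OF members_have_edges])
  have "?l n \<le> real (ex n {J5, F32}) / real (n choose 3)" if n: "n \<ge> 3" for n
  proof -
    have "card (edges (K4_blowup n)) \<le> ex n {J5, F32}"
      using card_edges_le_ex[OF three_graph_K4_blowup _ family_free_K4_blowup, of n]
      by (simp add: K4_blowup_def)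
    then have "4 * (n div 4) ^ 3 \<le> ex n {J5, F32}"
      using card_edges_K4_blowup[of n] by linarith
    then have "real (4 * (n div 4) ^ 3) \<le> real (ex n {J5, F32})"
      by (rule of_nat_mono)
    then have e: "4 * real (n div 4) ^ 3 \<le> real (ex n {J5, F32})"
      by (simp only: of_nat_mult of_nat_power of_nat_numeral)
    have "n \<le> 4 * (n div 4) + 3" by presburger
    then have "real n \<le> real (4 * (n div 4) + 3)" by (simp only: of_nat_le_iff)
    then have "(real n - 3) / 4 \<le> real (n div 4)" by simp
    then have "((real n - 3) / 4) ^ 3 \<le> real (n div 4) ^ 3"
      using n by (intro power_mono) auto
    then have "3 / 8 * (real n - 3) ^ 3 \<le> 6 * real (ex n {J5, F32})"
      using e by (simp add: power_divide)
    moreover have "0 < real (n choose 3)" using n by (simp add: zero_less_binomial_iff)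
    ultimately have "?l n \<le> 6 * real (ex n {J5, F32}) / (6 * real (n choose 3))"
      unfolding real_choose_3[OF n, symmetric] by (intro divide_right_mono) auto
    then show ?thesis by simp
  qed
  then show "\<exists>N. \<forall>n\<ge>N. ?l n \<le> real (ex n {J5, F32}) / real (n choose 3)" by blast
qed

text \<open>The factor 16 is 6 / (3/8): the six orderings of the edges make up at most 3/8 of all
  n^3 ordered triples. Replacing n^3 by n (n - 1) (n - 2) changes nothing in the limit.\<close>

lemma turan_density_J5_F32_le:
  assumes "\<And>G :: nat hypergraph. three_graph G \<Longrightarrow> finite (verts G) \<Longrightarrow>
    family_free {J5, F32} G
    \<Longrightarrow> 16 * card (edges G) \<le> card (verts G) ^ 3"
  shows "turan_density {J5, F32} \<le> 3 / 8"
proof (rule LIMSEQ_le)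
  let ?u = "\<lambda>n. 6 / 16 * real n ^ 3 / (real n * (real n - 1) * (real n - 2))"
  show "?u \<longlonglongrightarrow> 3 / 8" by real_asymp
  show "(\<lambda>n. real (ex n {J5, F32}) / real (n choose 3)) \<longlonglongrightarrow> turan_density {J5,
    F32}"
    by (rule turan_density_LIMSEQ[OF members_have_edges])
  have "real (ex n {J5, F32}) / real (n choose 3) \<le> ?u n" if n: "n \<ge> 3" for n
  proof -
    obtain G :: "nat hypergraph" where G: "three_graph G" "finite (verts G)" "card (verts G) = n"
      "family_free {J5, F32} G" "card (edges G) = ex n {J5, F32}"
      using ex_attained[OF members_have_edges] .
    have "16 * ex n {J5, F32} \<le> n ^ 3" using assms[OF G(1,2,4)] G(3,5) by simp
    then have "real (16 * ex n {J5, F32}) \<le> real (n ^ 3)"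
      by (rule of_nat_mono)
    then have "16 * real (ex n {J5, F32}) \<le> real n ^ 3"
      by (simp only: of_nat_mult of_nat_power of_nat_numeral)
    moreover have "0 < real (n choose 3)" using n by (simp add: zero_less_binomial_iff)
    ultimately have "6 * real (ex n {J5, F32}) / (6 * real (n choose 3)) \<le> ?u n"
      unfolding real_choose_3[OF n, symmetric] by (intro divide_right_mono) auto
    then show ?thesis by simp
  qed
  then show "\<exists>N. \<forall>n\<ge>N. real (ex n {J5, F32}) / real (n choose 3) \<le> ?u n" by blast
qed

section \<open>Sums over six-tuples\<close>

text \<open>Precomposition with a bijection of the index set permutes the tuples;
  \<open>restrict\<close> keeps the result extensional, hence in \<open>PiE\<close>.\<close>

lemma sum_PiE_permute:
  assumes p: "bij_betw p I I"
  shows "(\<Sum>f\<in>PiE I (\<lambda>_. V). F (restrict (f \<circ> p) I)) = (\<Sum>f\<in>PiE I (\<lambda>_.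
    V). F f)"
proof (rule sum.reindex_bij_betw)
  let ?q = "inv_into I p"
  have q: "?q i \<in> I" "p (?q i) = i" "?q (p i) = i" "p i \<in> I" if "i \<in> I" for i
    using p that by (auto simp: bij_betw_def inv_into_into f_inv_into_f inv_into_f_f)
  show "bij_betw (\<lambda>f. restrict (f \<circ> p) I) (PiE I (\<lambda>_. V)) (PiE I (\<lambda>_. V))"
  proof (rule bij_betw_byWitness[where f' = "\<lambda>f. restrict (f \<circ> ?q) I"])
    show "\<forall>f\<in>PiE I (\<lambda>_. V). restrict (restrict (f \<circ> p) I \<circ> ?q) I = f"
      using q by (fastforce simp: fun_eq_iff PiE_def extensional_def)
    show "\<forall>f\<in>PiE I (\<lambda>_. V). restrict (restrict (f \<circ> ?q) I \<circ> p) I = f"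
      using q by (fastforce simp: fun_eq_iff PiE_def extensional_def)
  qed (use q in \<open>auto simp: PiE_iff\<close>)
qed

lemma sum_PiE_lessThan_Suc:
  "(\<Sum>f\<in>PiE {..<Suc n} (\<lambda>_. V). F f) = (\<Sum>f\<in>PiE {..<n} (\<lambda>_. V).
    \<Sum>y\<in>V. F (f(n := y)))"
proof -
  have "(\<Sum>f\<in>PiE {..<Suc n} (\<lambda>_. V). F f)
      = (\<Sum>f\<in>(\<lambda>(y, f). f(n := y)) ` (V \<times> PiE {..<n} (\<lambda>_. V)). F f)"
    by (simp add: lessThan_Suc PiE_insert_eq)
  also have "\<dots> = (\<Sum>(y, f)\<in>V \<times> PiE {..<n} (\<lambda>_. V). F (f(n := y)))"
    by (subst sum.reindex[OF inj_combinator]) (auto simp: case_prod_unfold)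
  also have "\<dots> = (\<Sum>y\<in>V. \<Sum>f\<in>PiE {..<n} (\<lambda>_. V). F (f(n := y)))"
    by (simp add: sum.cartesian_product)
  finally show ?thesis by (subst (asm) sum.swap)
qed

text \<open>Tuples with repeated entries are included. The coordinates therefore vary independently,
  and the averaged products become exact squares without an error term of lower order.\<close>

definition tuple_sum :: "'a set \<Rightarrow> ('a \<Rightarrow> 'a \<Rightarrow> 'a \<Rightarrow> 'a
  \<Rightarrow> 'a \<Rightarrow> 'a \<Rightarrow> int) \<Rightarrow> int" where
  "tuple_sum V C = (\<Sum>f\<in>PiE {..<6::nat} (\<lambda>_. V). C (f 0) (f 1) (f 2) (f 3) (f 4) (f 5))"

text \<open>This moves a product attached to any labelling of the six points to the standard
  labelling 0, ..., 5, so nonnegativity has to be shown only there.\<close>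

lemma sum_tuples_permute:
  fixes C :: "'a \<Rightarrow> 'a \<Rightarrow> 'a \<Rightarrow> 'a \<Rightarrow> 'a \<Rightarrow> 'a
    \<Rightarrow> int"
  assumes "distinct [a, b, c, d, e, g]" "set [a, b, c, d, e, g] = {..<6::nat}"
  shows "(\<Sum>f\<in>PiE {..<6} (\<lambda>_. V). C (f a) (f b) (f c) (f d) (f e) (f g)) = tuple_sum V C"
proof -
  let ?l = "[a, b, c, d, e, g]"
  let ?F = "\<lambda>f. C (f 0) (f 1) (f 2) (f 3) (f 4) (f (5::nat))"
  have "bij_betw ((!) ?l) {..<6} {..<6}"
    using bij_betw_nth[OF assms(1), of "{..<6}" "{..<6}"] assms(2) by simp
  then have "(\<Sum>f\<in>PiE {..<6} (\<lambda>_. V). ?F (restrict (f \<circ> (!) ?l) {..<6})) =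
    (\<Sum>f\<in>PiE {..<6} (\<lambda>_. V). ?F f)"
    by (rule sum_PiE_permute)
  then show ?thesis by (simp add: tuple_sum_def)
qed

lemma tuple_sum_expand:
  "tuple_sum V C = (\<Sum>f\<in>PiE {..<4::nat} (\<lambda>_. V). \<Sum>y\<in>V. \<Sum>z\<in>V. C (f 0) (f 1)
    (f 2) (f 3) y z)"
proof -
  have "{..<6::nat} = {..<Suc (Suc 4)}" by simp
  then show ?thesis
    unfolding tuple_sum_def by (simp only: sum_PiE_lessThan_Suc) simp
qed

text \<open>For a fixed root a, b, c, d the points y and z are independent, so the inner double sum
  is the square of the sum over y. The condition \<open>s\<close> depends on the root alone and
  comes out of the sum.\<close>

lemma tuple_sum_square_nonneg:
  fixes g :: "'a \<Rightarrow> 'a \<Rightarrow> 'a \<Rightarrow> 'a \<Rightarrow> 'a \<Rightarrow> int"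
  shows "0 \<le> tuple_sum V (\<lambda>a b c d y z. (if s a b c d then g a b c d y * g a b c d z else 0))"
proof -
  have "(\<Sum>y\<in>V. \<Sum>z\<in>V. (if s a b c d then g a b c d y * g a b c d z else 0))
      = (if s a b c d then (\<Sum>y\<in>V. g a b c d y)\<^sup>2 else 0)" for a b c d
    by (simp add: power2_eq_square sum_product)
  then have "tuple_sum V (\<lambda>a b c d y z. (if s a b c d then g a b c d y * g a b c d z else 0))
      = (\<Sum>f\<in>PiE {..<4::nat} (\<lambda>_. V). if s (f 0) (f 1) (f 2) (f 3)
          then (\<Sum>y\<in>V. g (f 0) (f 1) (f 2) (f 3) y)\<^sup>2 else 0)"
    unfolding tuple_sum_expand by (intro sum.cong refl)
  then show ?thesis by (simp add: sum_nonneg)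
qed

text \<open>Here the root is a, b, and the independent parts are the pairs c, d and y, z.\<close>

lemma tuple_sum_pair_square_nonneg:
  fixes g :: "'a \<Rightarrow> 'a \<Rightarrow> 'a \<Rightarrow> 'a \<Rightarrow> int"
  shows "0 \<le> tuple_sum V (\<lambda>a b c d y z. g a b c d * g a b y z)"
proof -
  have four: "{..<4::nat} = {..<Suc (Suc 2)}" by simp
  have "(\<Sum>c\<in>V. \<Sum>d\<in>V. \<Sum>y\<in>V. \<Sum>z\<in>V. g a b c d * g a b y z) = (\<Sum>c\<in>V.
    \<Sum>d\<in>V. g a b c d)\<^sup>2" for a b
    unfolding power2_eq_square sum_distrib_right by (simp only: sum_distrib_left)
  then show ?thesis
    unfolding tuple_sum_expand four by (simp only: sum_PiE_lessThan_Suc) (simp add: sum_nonneg)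
qed

section \<open>The quadratic forms\<close>

definition quad_form :: "(int \<times> int list) list \<Rightarrow> nat \<Rightarrow> nat \<Rightarrow> int"
  where
  "quad_form S i j = (\<Sum>(c, v)\<leftarrow>S. c * (v ! i) * (v ! j))"

text \<open>Each pair \<open>(c, v)\<close> in the following four lists stands for \<open>c\<close> times the square of the linear form with
  coefficients \<open>v\<close>. The numbers are a rational rounding of a numerical solution of the semidefinite program
  of the flag algebra method on six vertices. Each form has mean zero on the balanced blow-up of \<open>K\<^sub>4\<^sup>3\<close>,
  as it must for the bound to be sharp.

  In \<open>pair_even\<close> and \<open>pair_odd\<close> the form is summed over two further vertices \<open>c, d\<close> of a pair \<open>a, b\<close>, and
  the coefficients are indexed by the isomorphism type of the graph on \<open>a, b, c, d\<close> (see \<open>pair_index\<close>);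
  the forms in \<open>pair_odd\<close> change sign under exchange of \<open>a\<close> and \<open>b\<close>. In \<open>quad_even\<close> and \<open>quad_odd\<close> the form is
  summed over one further vertex \<open>y\<close> of four vertices \<open>a, b, c, d\<close> that span exactly the edges \<open>abc\<close> and
  \<open>abd\<close>, and the coefficients are indexed by the link of \<open>y\<close> (see \<open>quad_index\<close>); the forms in \<open>quad_odd\<close>
  change sign under exchange of \<open>a\<close> and \<open>b\<close> and under exchange of \<open>c\<close> and \<open>d\<close>. A zero at an index that
  no \<open>F\<^sub>3\<^sub>,\<^sub>2\<close>-free graph attains is a placeholder.\<close>

definition pair_even :: "(int \<times> int list) list" where
  "pair_even =
   [(248832, [144, 147, 72, - 32, - 8, - 178, - 240, - 287, - 328]),
    (746496, [0, 92, 104, - 117, - 48, 135, 0, - 26, 88]),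
    (2239488, [0, 15, 0, - 13, 8, - 29, 0, - 13, - 32])]"

definition pair_odd :: "(int \<times> int list) list" where
  "pair_odd =
   [(86999040, [11, 12, 12]),
    (9172942848, [1, 0, 0])]"

definition quad_even :: "(int \<times> int list) list" where
  "quad_even =
   [(491, [2532, 2304, 672, 0, 1012, 3127, 293, 0, 2304, - 1274, 1118, 0, 1443, 2880, 0, 0, - 1835, 1033, -
     4252, 0, 522, - 1258, 0, 0, - 2880, - 6912, 0, 0]),
    (1921, [36, 2304, 1344, 0, 540, 1943, 773, 0, 0, 262, - 98, 0, 931, 1728, 0, 0, - 1667, 273, - 3372, 0, -
      902, - 866, 0, 0, - 2888, - 2304, 0, 0]),
    (76736, [312, 0, - 84, 0, 59, 148, - 60, 0, 288, - 192, 152, 0, 64, 144, 0, 0, - 21, 95, - 110, 0, 178, -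
      49, 0, 0, 1, - 576, 0, 0]),
    (39813120, [0, 0, 12, 0, 3, 2, 2, 0, 0, 4, - 8, 0, - 2, 0, 0, 0, 1, - 3, - 6, 0, - 2, - 5, 0, 0, 1, 0, 0,
      0]),
    (143424, [108, 0, - 48, 0, - 72, - 131, - 65, 0, 0, 2, - 94, 0, 17, - 288, 0, 0, 155, - 9, 180, 0, 38,
      110, 0, 0, - 124, 0, 0, 0]),
    (387072, [144, 0, 12, 0, 51, - 34, 86, 0, 0, 28, - 80, 0, 10, 0, 0, 0, - 11, - 63, - 54, 0, - 26, - 77,
      0, 0, - 95, 0, 0, 0])]"

definition quad_odd :: "(int \<times> int list) list" where
  "quad_odd =
   [(2400, [0, 0, 0, 0, 1090, - 511, 1400, 0, 0, 0, 0, 0, 0, 0, 0, 0, 2250, - 205, 5376, 0, - 518, - 1185, 0,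
     0, 0, 0, 0, 0]),
    (27171, [0, 0, 0, 0, 18, 159, - 672, 0, 0, 0, 0, 0, 0, 0, 0, 0, - 446, - 299, 0, 0, - 154, - 243, 0, 0,
      0, 0, 0, 0]),
    (44375515, [0, 0, 0, 0, 6, - 3, 0, 0, 0, 0, 0, 0, 0, 0, 0, 0, - 10, - 1, 0, 0, - 14, - 9, 0, 0, 0, 0, 0,
      0])]"

text \<open>The values are tabulated because the search below looks them up many thousand times.\<close>

lemma pair_even_table:
    "quad_form pair_even 0 0 = 5159780352" "quad_form pair_even 0 (Suc 0) = 5267275776"
    "quad_form pair_even 0 2 = 2579890176" "quad_form pair_even 0 3 = - 1146617856"
    "quad_form pair_even 0 4 = - 286654464" "quad_form pair_even 0 5 = - 6378061824"
    "quad_form pair_even 0 6 = - 8599633920" "quad_form pair_even 0 7 = - 10283728896"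
    "quad_form pair_even 0 8 = - 11752833024" "quad_form pair_even (Suc 0) 0 = 5267275776"
    "quad_form pair_even (Suc 0) (Suc 0) = 12199237632" "quad_form pair_even (Suc 0) 2 = 9776111616"
    "quad_form pair_even (Suc 0) 3 = - 9642488832" "quad_form pair_even (Suc 0) 4 = - 3320414208"
    "quad_form pair_even (Suc 0) 5 = 1786364928" "quad_form pair_even (Suc 0) 6 = - 8778792960"
    "quad_form pair_even (Suc 0) 7 = - 12720291840" "quad_form pair_even (Suc 0) 8 = - 7029006336"
    "quad_form pair_even 2 0 = 2579890176" "quad_form pair_even 2 (Suc 0) = 9776111616"
    "quad_form pair_even 2 2 = 9364045824" "quad_form pair_even 2 3 = - 9656672256"
    "quad_form pair_even 2 4 = - 3869835264" "quad_form pair_even 2 5 = 7291772928"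
    "quad_form pair_even 2 6 = - 4299816960" "quad_form pair_even 2 7 = - 7160389632"
    "quad_form pair_even 2 8 = 955514880" "quad_form pair_even 3 0 = - 1146617856"
    "quad_form pair_even 3 (Suc 0) = - 9642488832" "quad_form pair_even 3 2 = - 9656672256"
    "quad_form pair_even 3 3 = 10852061184" "quad_form pair_even 3 4 = 4023115776"
    "quad_form pair_even 3 5 = - 9529270272" "quad_form pair_even 3 6 = 1911029760"
    "quad_form pair_even 3 7 = 4934587392" "quad_form pair_even 3 8 = - 4142555136"
    "quad_form pair_even 4 0 = - 286654464" "quad_form pair_even 4 (Suc 0) = - 3320414208"
    "quad_form pair_even 4 2 = - 3869835264" "quad_form pair_even 4 3 = 4023115776"
    "quad_form pair_even 4 4 = 1879179264" "quad_form pair_even 4 5 = - 5002518528"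
    "quad_form pair_even 4 6 = 477757440" "quad_form pair_even 4 7 = 1270038528"
    "quad_form pair_even 4 8 = - 3073572864" "quad_form pair_even 5 0 = - 6378061824"
    "quad_form pair_even 5 (Suc 0) = 1786364928" "quad_form pair_even 5 2 = 7291772928"
    "quad_form pair_even 5 3 = - 9529270272" "quad_form pair_even 5 4 = - 5002518528"
    "quad_form pair_even 5 5 = 23372292096" "quad_form pair_even 5 6 = 10630103040"
    "quad_form pair_even 5 7 = 10935917568" "quad_form pair_even 5 8 = 25474424832"
    "quad_form pair_even 6 0 = - 8599633920" "quad_form pair_even 6 (Suc 0) = - 8778792960"
    "quad_form pair_even 6 2 = - 4299816960" "quad_form pair_even 6 3 = 1911029760"
    "quad_form pair_even 6 4 = 477757440" "quad_form pair_even 6 5 = 10630103040"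
    "quad_form pair_even 6 6 = 14332723200" "quad_form pair_even 6 7 = 17139548160"
    "quad_form pair_even 6 8 = 19588055040" "quad_form pair_even 7 0 = - 10283728896"
    "quad_form pair_even 7 (Suc 0) = - 12720291840" "quad_form pair_even 7 2 = - 7160389632"
    "quad_form pair_even 7 3 = 4934587392" "quad_form pair_even 7 4 = 1270038528"
    "quad_form pair_even 7 5 = 10935917568" "quad_form pair_even 7 6 = 17139548160"
    "quad_form pair_even 7 7 = 21379147776" "quad_form pair_even 7 8 = 22647693312"
    "quad_form pair_even 8 0 = - 11752833024" "quad_form pair_even 8 (Suc 0) = - 7029006336"
    "quad_form pair_even 8 2 = 955514880" "quad_form pair_even 8 3 = - 4142555136"
    "quad_form pair_even 8 4 = - 3073572864" "quad_form pair_even 8 5 = 25474424832"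
    "quad_form pair_even 8 6 = 19588055040" "quad_form pair_even 8 7 = 22647693312"
    "quad_form pair_even 8 8 = 34844442624"
  by (simp_all add: quad_form_def pair_even_def)

text \<open>The indices 1 and 2 appear as successors because this is the form in which
  simplification leaves \<open>of_bool x + of_bool y\<close>.\<close>

lemma pair_odd_table:
    "quad_form pair_odd 0 0 = 19699826688" "quad_form pair_odd 0 (Suc 0) = 11483873280"
    "quad_form pair_odd 0 (Suc (Suc 0)) = 11483873280" "quad_form pair_odd (Suc 0) 0 = 11483873280"
    "quad_form pair_odd (Suc 0) (Suc 0) = 12527861760" "quad_form pair_odd (Suc 0) (Suc (Suc 0)) = 12527861760"
    "quad_form pair_odd (Suc (Suc 0)) 0 = 11483873280" "quad_form pair_odd (Suc (Suc 0)) (Suc 0) = 12527861760"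
    "quad_form pair_odd (Suc (Suc 0)) (Suc (Suc 0)) = 12527861760"
  by (simp_all add: quad_form_def pair_odd_def)

text \<open>The indices left out occur in no \<open>F32\<close>-free graph. Index 3 modulo 4 means
  that \<open>aby\<close> and \<open>cdy\<close> are edges, and then \<open>abc\<close>,
  \<open>abd\<close>, \<open>aby\<close>, \<open>cdy\<close> form a copy of \<open>F32\<close>. At
  14, 22 and 26 either \<open>cya\<close>, \<open>cyb\<close>, \<open>cyd\<close> are edges, which
  together with \<open>abd\<close> form a copy, or the same holds with c and d exchanged.\<close>

lemma quad_even_table:
    "quad_form quad_even 0 0 = 20319314112" "quad_form quad_even 0 (Suc 0) = 3023695872"
    "quad_form quad_even 0 (Suc (Suc 0)) = - 1157362560" "quad_form quad_even 0 4 = 4435422816"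
    "quad_form quad_even 0 5 = 3640988304" "quad_form quad_even 0 6 = 2767883952"
    "quad_form quad_even 0 8 = 9759550464" "quad_form quad_even 0 9 = - 4570872672"
    "quad_form quad_even 0 10 = - 892848096" "quad_form quad_even 0 12 = 4211313744"
    "quad_form quad_even 0 13 = 2686487040" "quad_form quad_even 0 16 = - 1111555632"
    "quad_form quad_even 0 17 = - 73352688" "quad_form quad_even 0 18 = - 8374620288"
    "quad_form quad_even 0 20 = 3987602976" "quad_form quad_even 0 21 = - 5384966976"
    "quad_form quad_even 0 24 = - 10972110624" "quad_form quad_even 0 25 = - 22542796800"
    "quad_form quad_even (Suc 0) 0 = 3023695872" "quad_form quad_even (Suc 0) (Suc 0) = 12803899392"
    "quad_form quad_even (Suc 0) (Suc (Suc 0)) = 6708731904" "quad_form quad_even (Suc 0) 4 = 3534870528"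
    "quad_form quad_even (Suc 0) 5 = 12137149440" "quad_form quad_even (Suc 0) 6 = 3752745984"
    "quad_form quad_even (Suc 0) 8 = 2606432256" "quad_form quad_even (Suc 0) 9 = - 281622528"
    "quad_form quad_even (Suc 0) 10 = 831006720" "quad_form quad_even (Suc 0) 12 = 5753005056"
    "quad_form quad_even (Suc 0) 13 = 10906140672" "quad_form quad_even (Suc 0) 16 = - 9453984768"
    "quad_form quad_even (Suc 0) 17 = 2376889344" "quad_form quad_even (Suc 0) 18 = - 19734552576"
    "quad_form quad_even (Suc 0) 20 = - 3401717760" "quad_form quad_even (Suc 0) 21 = - 5256032256"
    "quad_form quad_even (Suc 0) 24 = - 16040282112" "quad_form quad_even (Suc 0) 25 = - 18016763904"
    "quad_form quad_even (Suc (Suc 0)) 0 = - 1157362560"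
    "quad_form quad_even (Suc (Suc 0)) (Suc 0) = 6708731904"
    "quad_form quad_even (Suc (Suc 0)) (Suc (Suc 0)) = 10352424960"
    "quad_form quad_even (Suc (Suc 0)) 4 = 3513626496" "quad_form quad_even (Suc (Suc 0)) 5 = 6793701600"
    "quad_form quad_even (Suc (Suc 0)) 6 = 4281631392" "quad_form quad_even (Suc (Suc 0)) 8 = - 1096187904"
    "quad_form quad_even (Suc (Suc 0)) 9 = 3520994496" "quad_form quad_even (Suc (Suc 0)) 10 = - 4410417216"
    "quad_form quad_even (Suc (Suc 0)) 12 = 1441165920" "quad_form quad_even (Suc (Suc 0)) 13 = 6466148352"
    "quad_form quad_even (Suc (Suc 0)) 16 = - 5414410848" "quad_form quad_even (Suc (Suc 0)) 17 = - 1230614496"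
    "quad_form quad_even (Suc (Suc 0)) 18 = - 13756376448"
    "quad_form quad_even (Suc (Suc 0)) 20 = - 4641813696" "quad_form quad_even (Suc (Suc 0)) 21 = - 5838814272"
    "quad_form quad_even (Suc (Suc 0)) 24 = - 7522860288" "quad_form quad_even (Suc (Suc 0)) 25 = - 4516356096"
    "quad_form quad_even 4 0 = 4435422816" "quad_form quad_even 4 (Suc 0) = 3534870528"
    "quad_form quad_even 4 (Suc (Suc 0)) = 3513626496" "quad_form quad_even 4 4 = 3438738688"
    "quad_form quad_even 4 5 = 5159862696" "quad_form quad_even 4 6 = 3283608568"
    "quad_form quad_even 4 8 = 2448737280" "quad_form quad_even 4 9 = - 220679536"
    "quad_form quad_even 4 10 = - 422040624" "quad_form quad_even 4 12 = 1755510856"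
    "quad_form quad_even 4 13 = 6849561600" "quad_form quad_even 4 16 = - 4434438376"
    "quad_form quad_even 4 17 = - 282453128" "quad_form quad_even 4 18 = - 9750119392"
    "quad_form quad_even 4 20 = - 1014965840" "quad_form quad_even 4 21 = - 4998416976"
    "quad_form quad_even 4 24 = - 4897794464" "quad_form quad_even 4 25 = - 8432345088"
    "quad_form quad_even 5 0 = 3640988304" "quad_form quad_even 5 (Suc 0) = 12137149440"
    "quad_form quad_even 5 (Suc (Suc 0)) = 6793701600" "quad_form quad_even 5 4 = 5159862696"
    "quad_form quad_even 5 5 = 16802146988" "quad_form quad_even 5 6 = 2902378052"
    "quad_form quad_even 5 8 = 6808257792" "quad_form quad_even 5 9 = - 3246223880"
    "quad_form quad_even 5 10 = 5258945944" "quad_form quad_even 5 12 = 5807061628"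
    "quad_form quad_even 5 13 = 17918091648" "quad_form quad_even 5 16 = - 11965791236"
    "quad_form quad_even 5 17 = 4443231660" "quad_form quad_even 5 18 = - 23512631328"
    "quad_form quad_even 5 20 = - 1074773672" "quad_form quad_even 5 21 = - 7171832720"
    "quad_form quad_even 5 24 = - 11530291640" "quad_form quad_even 5 25 = - 25753665024"
    "quad_form quad_even 6 0 = 2767883952" "quad_form quad_even 6 (Suc 0) = 3752745984"
    "quad_form quad_even 6 (Suc (Suc 0)) = 4281631392" "quad_form quad_even 6 4 = 3283608568"
    "quad_form quad_even 6 5 = 2902378052" "quad_form quad_even 6 6 = 5094258060"
    "quad_form quad_even 6 8 = - 994537728" "quad_form quad_even 6 9 = 2321698920"
    "quad_form quad_even 6 10 = - 3108261560" "quad_form quad_even 6 12 = 1310546612"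
    "quad_form quad_even 6 13 = 5002187904" "quad_form quad_even 6 16 = - 4374225228"
    "quad_form quad_even 6 17 = - 2135529788" "quad_form quad_even 6 18 = - 9065822560"
    "quad_form quad_even 6 20 = - 3462856312" "quad_form quad_even 6 21 = - 5228131376"
    "quad_form quad_even 6 24 = - 6634170664" "quad_form quad_even 6 25 = - 1763670528"
    "quad_form quad_even 8 0 = 9759550464" "quad_form quad_even 8 (Suc 0) = 2606432256"
    "quad_form quad_even 8 (Suc (Suc 0)) = - 1096187904" "quad_form quad_even 8 4 = 2448737280"
    "quad_form quad_even 8 5 = 6808257792" "quad_form quad_even 8 6 = - 994537728"
    "quad_form quad_even 8 8 = 8971223040" "quad_form quad_even 8 9 = - 5684424192"
    "quad_form quad_even 8 10 = 4623948288" "quad_form quad_even 8 12 = 3046811904"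
    "quad_form quad_even 8 13 = 6440435712" "quad_form quad_even 8 16 = - 2539968768"
    "quad_form quad_even 8 17 = 3268092672" "quad_form quad_even 8 18 = - 7241131008"
    "quad_form quad_even 8 20 = 4524314112" "quad_form quad_even 8 21 = - 2506028544"
    "quad_form quad_even 8 24 = - 3235940352" "quad_form quad_even 8 25 = - 20548878336"
    "quad_form quad_even 9 0 = - 4570872672" "quad_form quad_even 9 (Suc 0) = - 281622528"
    "quad_form quad_even 9 (Suc (Suc 0)) = 3520994496" "quad_form quad_even 9 4 = - 220679536"
    "quad_form quad_even 9 5 = - 3246223880" "quad_form quad_even 9 6 = 2321698920"
    "quad_form quad_even 9 8 = - 5684424192" "quad_form quad_even 9 9 = 4698639408"
    "quad_form quad_even 9 10 = - 5156158864" "quad_form quad_even 9 12 = - 1582251752"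
    "quad_form quad_even 9 13 = - 3136041216" "quad_form quad_even 9 16 = 702745752"
    "quad_form quad_even 9 17 = - 3071573896" "quad_form quad_even 9 18 = 1094165440"
    "quad_form quad_even 9 20 = - 3992429840" "quad_form quad_even 9 21 = - 526241824"
    "quad_form quad_even 9 24 = - 572659760" "quad_form quad_even 9 25 = 11650470912"
    "quad_form quad_even 10 0 = - 892848096" "quad_form quad_even 10 (Suc 0) = 831006720"
    "quad_form quad_even 10 (Suc (Suc 0)) = - 4410417216" "quad_form quad_even 10 4 = - 422040624"
    "quad_form quad_even 10 5 = 5258945944" "quad_form quad_even 10 6 = - 3108261560"
    "quad_form quad_even 10 8 = 4623948288" "quad_form quad_even 10 9 = - 5156158864"
    "quad_form quad_even 10 10 = 8697665456" "quad_form quad_even 10 12 = 1461497912"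
    "quad_form quad_even 10 13 = 6818003712" "quad_form quad_even 10 16 = - 3005985736"
    "quad_form quad_even 10 17 = 4651420824" "quad_form quad_even 10 18 = - 1825857600"
    "quad_form quad_even 10 20 = 3462332720" "quad_form quad_even 10 21 = 1394821856"
    "quad_form quad_even 10 24 = 3269403920" "quad_form quad_even 10 25 = - 10078903296"
    "quad_form quad_even 12 0 = 4211313744" "quad_form quad_even 12 (Suc 0) = 5753005056"
    "quad_form quad_even 12 (Suc (Suc 0)) = 1441165920" "quad_form quad_even 12 4 = 1755510856"
    "quad_form quad_even 12 5 = 5807061628" "quad_form quad_even 12 6 = 1310546612"
    "quad_form quad_even 12 8 = 3046811904" "quad_form quad_even 12 9 = - 1582251752"
    "quad_form quad_even 12 10 = 1461497912" "quad_form quad_even 12 12 = 3241152012"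
    "quad_form quad_even 12 13 = 5135955840" "quad_form quad_even 12 16 = - 4128884276"
    "quad_form quad_even 12 17 = 1659775420" "quad_form quad_even 12 18 = - 8875859488"
    "quad_form quad_even 12 20 = - 217896840" "quad_form quad_even 12 21 = - 2312463376"
    "quad_form quad_even 12 24 = - 7950335256" "quad_form quad_even 12 25 = - 11846628864"
    "quad_form quad_even 13 0 = 2686487040" "quad_form quad_even 13 (Suc 0) = 10906140672"
    "quad_form quad_even 13 (Suc (Suc 0)) = 6466148352" "quad_form quad_even 13 4 = 6849561600"
    "quad_form quad_even 13 5 = 17918091648" "quad_form quad_even 13 6 = 5002187904"
    "quad_form quad_even 13 8 = 6440435712" "quad_form quad_even 13 9 = - 3136041216"
    "quad_form quad_even 13 10 = 6818003712" "quad_form quad_even 13 12 = 5135955840"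
    "quad_form quad_even 13 13 = 23295983616" "quad_form quad_even 13 16 = - 14762920320"
    "quad_form quad_even 13 17 = 3788468352" "quad_form quad_even 13 18 = - 25856580096"
    "quad_form quad_even 13 20 = - 1858763520" "quad_form quad_even 13 21 = - 9738710784"
    "quad_form quad_even 13 24 = - 8526223872" "quad_form quad_even 13 25 = - 23787012096"
    "quad_form quad_even 16 0 = - 1111555632" "quad_form quad_even 16 (Suc 0) = - 9453984768"
    "quad_form quad_even 16 (Suc (Suc 0)) = - 5414410848" "quad_form quad_even 16 4 = - 4434438376"
    "quad_form quad_even 16 5 = - 11965791236" "quad_form quad_even 16 6 = - 4374225228"
    "quad_form quad_even 16 8 = - 2539968768" "quad_form quad_even 16 9 = 702745752"
    "quad_form quad_even 16 10 = - 3005985736" "quad_form quad_even 16 12 = - 4128884276"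
    "quad_form quad_even 16 13 = - 14762920320" "quad_form quad_even 16 16 = 10557804252"
    "quad_form quad_even 16 17 = - 2009310580" "quad_form quad_even 16 18 = 18798999232"
    "quad_form quad_even 16 20 = 3007171288" "quad_form quad_even 16 21 = 6559761920"
    "quad_form quad_even 16 24 = 9529182040" "quad_form quad_even 16 25 = 14533922304"
    "quad_form quad_even 17 0 = - 73352688" "quad_form quad_even 17 (Suc 0) = 2376889344"
    "quad_form quad_even 17 (Suc (Suc 0)) = - 1230614496" "quad_form quad_even 17 4 = - 282453128"
    "quad_form quad_even 17 5 = 4443231660" "quad_form quad_even 17 6 = - 2135529788"
    "quad_form quad_even 17 8 = 3268092672" "quad_form quad_even 17 9 = - 3071573896"
    "quad_form quad_even 17 10 = 4651420824" "quad_form quad_even 17 12 = 1659775420"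
    "quad_form quad_even 17 13 = 3788468352" "quad_form quad_even 17 16 = - 2009310580"
    "quad_form quad_even 17 17 = 3265877500" "quad_form quad_even 17 18 = - 2925798208"
    "quad_form quad_even 17 20 = 1913178808" "quad_form quad_even 17 21 = 883466880"
    "quad_form quad_even 17 24 = - 610769480" "quad_form quad_even 17 25 = - 8913074688"
    "quad_form quad_even 18 0 = - 8374620288" "quad_form quad_even 18 (Suc 0) = - 19734552576"
    "quad_form quad_even 18 (Suc (Suc 0)) = - 13756376448" "quad_form quad_even 18 4 = - 9750119392"
    "quad_form quad_even 18 5 = - 23512631328" "quad_form quad_even 18 6 = - 9065822560"
    "quad_form quad_even 18 8 = - 7241131008" "quad_form quad_even 18 9 = 1094165440"
    "quad_form quad_even 18 10 = - 1825857600" "quad_form quad_even 18 12 = - 8875859488"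
    "quad_form quad_even 18 13 = - 25856580096" "quad_form quad_even 18 16 = 18798999232"
    "quad_form quad_even 18 17 = - 2925798208" "quad_form quad_even 18 18 = 38856961600"
    "quad_form quad_even 18 20 = 5252745728" "quad_form quad_even 18 21 = 14293220064"
    "quad_form quad_even 18 24 = 23257147616" "quad_form quad_even 18 25 = 34216814592"
    "quad_form quad_even 20 0 = 3987602976" "quad_form quad_even 20 (Suc 0) = - 3401717760"
    "quad_form quad_even 20 (Suc (Suc 0)) = - 4641813696" "quad_form quad_even 20 4 = - 1014965840"
    "quad_form quad_even 20 5 = - 1074773672" "quad_form quad_even 20 6 = - 3462856312"
    "quad_form quad_even 20 8 = 4524314112" "quad_form quad_even 20 9 = - 3992429840"
    "quad_form quad_even 20 10 = 3462332720" "quad_form quad_even 20 12 = - 217896840"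
    "quad_form quad_even 20 13 = - 1858763520" "quad_form quad_even 20 16 = 3007171288"
    "quad_form quad_even 20 17 = 1913178808" "quad_form quad_even 20 18 = 5252745728"
    "quad_form quad_even 20 20 = 4756043760" "quad_form quad_even 20 21 = 2281396928"
    "quad_form quad_even 20 24 = 4480295856" "quad_form quad_even 20 25 = - 5646910464"
    "quad_form quad_even 21 0 = - 5384966976" "quad_form quad_even 21 (Suc 0) = - 5256032256"
    "quad_form quad_even 21 (Suc (Suc 0)) = - 5838814272" "quad_form quad_even 21 4 = - 4998416976"
    "quad_form quad_even 21 5 = - 7171832720" "quad_form quad_even 21 6 = - 5228131376"
    "quad_form quad_even 21 8 = - 2506028544" "quad_form quad_even 21 9 = - 526241824"
    "quad_form quad_even 21 10 = 1394821856" "quad_form quad_even 21 12 = - 2312463376"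
    "quad_form quad_even 21 13 = - 9738710784" "quad_form quad_even 21 16 = 6559761920"
    "quad_form quad_even 21 17 = 883466880" "quad_form quad_even 21 18 = 14293220064"
    "quad_form quad_even 21 20 = 2281396928" "quad_form quad_even 21 21 = 7427655824"
    "quad_form quad_even 21 24 = 7255651664" "quad_form quad_even 21 25 = 10268089344"
    "quad_form quad_even 24 0 = - 10972110624" "quad_form quad_even 24 (Suc 0) = - 16040282112"
    "quad_form quad_even 24 (Suc (Suc 0)) = - 7522860288" "quad_form quad_even 24 4 = - 4897794464"
    "quad_form quad_even 24 5 = - 11530291640" "quad_form quad_even 24 6 = - 6634170664"
    "quad_form quad_even 24 8 = - 3235940352" "quad_form quad_even 24 9 = - 572659760"
    "quad_form quad_even 24 10 = 3269403920" "quad_form quad_even 24 12 = - 7950335256"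
    "quad_form quad_even 24 13 = - 8526223872" "quad_form quad_even 24 16 = 9529182040"
    "quad_form quad_even 24 17 = - 610769480" "quad_form quad_even 24 18 = 23257147616"
    "quad_form quad_even 24 20 = 4480295856" "quad_form quad_even 24 21 = 7255651664"
    "quad_form quad_even 24 24 = 25833237504" "quad_form quad_even 24 25 = 22512162816"
    "quad_form quad_even 25 0 = - 22542796800" "quad_form quad_even 25 (Suc 0) = - 18016763904"
    "quad_form quad_even 25 (Suc (Suc 0)) = - 4516356096" "quad_form quad_even 25 4 = - 8432345088"
    "quad_form quad_even 25 5 = - 25753665024" "quad_form quad_even 25 6 = - 1763670528"
    "quad_form quad_even 25 8 = - 20548878336" "quad_form quad_even 25 9 = 11650470912"
    "quad_form quad_even 25 10 = - 10078903296" "quad_form quad_even 25 12 = - 11846628864"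
    "quad_form quad_even 25 13 = - 23787012096" "quad_form quad_even 25 16 = 14533922304"
    "quad_form quad_even 25 17 = - 8913074688" "quad_form quad_even 25 18 = 34216814592"
    "quad_form quad_even 25 20 = - 5646910464" "quad_form quad_even 25 21 = 10268089344"
    "quad_form quad_even 25 24 = 22512162816" "quad_form quad_even 25 25 = 59114520576"
  by (simp_all add: quad_form_def quad_even_def)

text \<open>Only the shapes 1, 4 and 5 have a nonzero \<open>twist\<close>; at all other indices the
  odd form is multiplied by zero.\<close>

lemma quad_odd_table:
    "quad_form quad_odd 4 4 = 4457761944" "quad_form quad_odd 4 5 = - 2057771868"
    "quad_form quad_odd 4 6 = 3333739584" "quad_form quad_odd 4 16 = 3005340312"
    "quad_form quad_odd 4 17 = - 948767412" "quad_form quad_odd 4 18 = 14063616000"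
    "quad_form quad_odd 4 20 = - 5157949272" "quad_form quad_odd 4 21 = - 5615083764"
    "quad_form quad_odd 5 4 = - 2057771868" "quad_form quad_odd 5 5 = 1712980086"
    "quad_form quad_odd 5 6 = - 4620127008" "quad_form quad_odd 5 16 = - 3354938844"
    "quad_form quad_odd 5 17 = - 907197966" "quad_form quad_odd 5 18 = - 6593126400"
    "quad_form quad_odd 5 20 = 1833737724" "quad_form quad_odd 5 21 = 1601616978"
    "quad_form quad_odd 6 4 = 3333739584" "quad_form quad_odd 6 5 = - 4620127008"
    "quad_form quad_odd 6 6 = 16973988864" "quad_form quad_odd 6 16 = 15703474752"
    "quad_form quad_odd 6 17 = 4770614688" "quad_form quad_odd 6 18 = 18063360000"
    "quad_form quad_odd 6 20 = 1071392448" "quad_form quad_odd 6 21 = 455315616"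
    "quad_form quad_odd 16 4 = 3005340312" "quad_form quad_odd 16 5 = - 3354938844"
    "quad_form quad_odd 16 6 = 15703474752" "quad_form quad_odd 16 16 = 21992298136"
    "quad_form quad_odd 16 17 = 2960116684" "quad_form quad_odd 16 18 = 29030400000"
    "quad_form quad_odd 16 20 = 5281585064" "quad_form quad_odd 16 21 = 539534988"
    "quad_form quad_odd 17 4 = - 948767412" "quad_form quad_odd 17 5 = - 907197966"
    "quad_form quad_odd 17 6 = 4770614688" "quad_form quad_odd 17 16 = 2960116684"
    "quad_form quad_odd 17 17 = 2574350086" "quad_form quad_odd 17 18 = - 2644992000"
    "quad_form quad_odd 17 20 = 2127229076" "quad_form quad_odd 17 21 = 2956562982"
    "quad_form quad_odd 18 4 = 14063616000" "quad_form quad_odd 18 5 = - 6593126400"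
    "quad_form quad_odd 18 6 = 18063360000" "quad_form quad_odd 18 16 = 29030400000"
    "quad_form quad_odd 18 17 = - 2644992000" "quad_form quad_odd 18 18 = 69363302400"
    "quad_form quad_odd 18 20 = - 6683443200" "quad_form quad_odd 18 21 = - 15289344000"
    "quad_form quad_odd 20 4 = - 5157949272" "quad_form quad_odd 20 5 = 1833737724"
    "quad_form quad_odd 20 6 = 1071392448" "quad_form quad_odd 20 16 = 5281585064"
    "quad_form quad_odd 20 17 = 2127229076" "quad_form quad_odd 20 18 = - 6683443200"
    "quad_form quad_odd 20 20 = 9985965976" "quad_form quad_odd 20 21 = 8081300052"
    "quad_form quad_odd 21 4 = - 5615083764" "quad_form quad_odd 21 5 = 1601616978"
    "quad_form quad_odd 21 6 = 455315616" "quad_form quad_odd 21 16 = 539534988"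
    "quad_form quad_odd 21 17 = 2956562982" "quad_form quad_odd 21 18 = - 15289344000"
    "quad_form quad_odd 21 20 = 8081300052" "quad_form quad_odd 21 21 = 8568977094"
  by (simp_all add: quad_form_def quad_odd_def)

section \<open>Products of two forms, as functions of a 3-graph on six vertices\<close>

definition pair_index :: "bool \<Rightarrow> bool \<Rightarrow> bool \<Rightarrow> bool \<Rightarrow> nat" where
  "pair_index x y z w = of_bool x + of_bool y + 3 * (of_bool z + of_bool w)"

text \<open>The arguments are the triples \<open>abc, abd, acd, bcd\<close>, followed by the same
  triples with y, z in place of c, d. Exchanging a and b changes the sign of both differences in the
  odd part, so their product is unchanged.\<close>

definition pair_kernel :: "bool \<Rightarrow> bool \<Rightarrow> bool \<Rightarrow> bool \<Rightarrow> bool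
  \<Rightarrow> bool \<Rightarrow> bool \<Rightarrow> bool \<Rightarrow> int" where
  "pair_kernel x y z w x' y' z' w' =
     quad_form pair_even (pair_index x y z w) (pair_index x' y' z' w') +
     (of_bool z - of_bool w) * (of_bool z' - of_bool w') *
       quad_form pair_odd (of_bool x + of_bool y) (of_bool x' + of_bool y')"

text \<open>The orbits of the subsets of the 4-cycle \<open>acbd\<close> under the exchanges \<open>a \<leftrightarrow> b\<close> and \<open>c \<leftrightarrow> d\<close>.\<close>

definition shape :: "bool \<Rightarrow> bool \<Rightarrow> bool \<Rightarrow> bool \<Rightarrow> nat" where
  "shape ac ad bc bd =
     (if ac = bd \<and> ad = bc then (if ac = ad then (if ac then 6 else 0) else 4)
      else if ac = ad \<and> bc = bd then 2
      else if ac = bc \<and> ad = bd then 3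
      else if (ac = bd \<and> ac) \<or> (ad = bc \<and> ad) then 5 else 1)"

definition quad_index :: "bool \<Rightarrow> bool \<Rightarrow> bool \<Rightarrow> bool \<Rightarrow> bool
  \<Rightarrow> bool \<Rightarrow> nat" where
  "quad_index ab ac ad bc bd cd = of_bool ab + 2 * of_bool cd + 4 * shape ac ad bc bd"

text \<open>This compares the two perfect matchings \<open>ac, bd\<close> and \<open>ad, bc\<close>
  of the 4-cycle. Each of the two exchanges interchanges the matchings, which gives the sign change
  required of the odd forms.\<close>

definition twist :: "bool \<Rightarrow> bool \<Rightarrow> bool \<Rightarrow> bool \<Rightarrow> int" where
  "twist ac ad bc bd = sgn (of_bool ac + of_bool bd - of_bool ad - of_bool bc)"

definition quad_kernel :: "bool \<Rightarrow> bool \<Rightarrow> bool \<Rightarrow> bool \<Rightarrow> bool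
  \<Rightarrow> bool \<Rightarrow>
    bool \<Rightarrow> bool \<Rightarrow> bool \<Rightarrow> bool \<Rightarrow> bool \<Rightarrow> bool
      \<Rightarrow> int" where
  "quad_kernel ab ac ad bc bd cd ab' ac' ad' bc' bd' cd' =
     quad_form quad_even (quad_index ab ac ad bc bd cd) (quad_index ab' ac' ad' bc' bd' cd') +
     twist ac ad bc bd * twist ac' ad' bc' bd' *
       quad_form quad_odd (quad_index ab ac ad bc bd cd) (quad_index ab' ac' ad' bc' bd' cd')"

text \<open>The form for four vertices that span exactly the edges \<open>abc, abd, acd\<close>; here a single square suffices.\<close>

definition apex :: "bool \<Rightarrow> bool \<Rightarrow> bool \<Rightarrow> bool \<Rightarrow> bool
  \<Rightarrow> bool \<Rightarrow> int" where
  "apex ab ac ad bc bd cd =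
     (if bc \<and> bd \<and> cd then (if ab \<or> ac \<or> ad then 0 else 1)
      else if bc \<or> bd \<or> cd then 0
      else if ab \<and> ac \<and> ad then - 2
      else if (ab \<and> ac) \<or> (ab \<and> ad) \<or> (ac \<and> ad) then 1 else 0)"

definition apex_weight :: int where
  "apex_weight = 12469469184"

definition apex_kernel :: "bool \<Rightarrow> bool \<Rightarrow> bool \<Rightarrow> bool \<Rightarrow> bool
  \<Rightarrow> bool \<Rightarrow>
    bool \<Rightarrow> bool \<Rightarrow> bool \<Rightarrow> bool \<Rightarrow> bool \<Rightarrow> bool
      \<Rightarrow> int" where
  "apex_kernel ab ac ad bc bd cd ab' ac' ad' bc' bd' cd' =
     apex_weight * (apex ab ac ad bc bd cd * apex ab' ac' ad' bc' bd' cd')"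

text \<open>\<open>e1, e2, e3, e4\<close> are the triples \<open>pqr, pqs, prs, qrs\<close>; the
  other arguments are the links of u and of v on the pairs from p, q, r, s. The ten conditions
  exclude each other: six choices for the common pair of two edges and four for the common vertex of
  three edges. Listing all of them makes the value independent of the order of p, q, r, s.\<close>

definition core :: "bool \<Rightarrow> bool \<Rightarrow> bool \<Rightarrow> bool \<Rightarrow>
    bool \<Rightarrow> bool \<Rightarrow> bool \<Rightarrow> bool \<Rightarrow> bool \<Rightarrow> bool
      \<Rightarrow>
    bool \<Rightarrow> bool \<Rightarrow> bool \<Rightarrow> bool \<Rightarrow> bool \<Rightarrow> bool
      \<Rightarrow> int" where
  "core e1 e2 e3 e4 pq pr ps qr qs rs pq' pr' ps' qr' qs' rs' =
     (if e1 \<and> e2 \<and> \<not> e3 \<and> \<not> e4 then quad_kernel pq pr ps qr qs rs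
         pq' pr' ps' qr' qs' rs' else 0) +
     (if e1 \<and> e3 \<and> \<not> e2 \<and> \<not> e4 then quad_kernel pr pq ps qr rs qs
         pr' pq' ps' qr' rs' qs' else 0) +
     (if e2 \<and> e3 \<and> \<not> e1 \<and> \<not> e4 then quad_kernel ps pq pr qs rs qr
         ps' pq' pr' qs' rs' qr' else 0) +
     (if e1 \<and> e4 \<and> \<not> e2 \<and> \<not> e3 then quad_kernel qr pq qs pr rs ps
         qr' pq' qs' pr' rs' ps' else 0) +
     (if e2 \<and> e4 \<and> \<not> e1 \<and> \<not> e3 then quad_kernel qs pq qr ps rs pr
         qs' pq' qr' ps' rs' pr' else 0) +
     (if e3 \<and> e4 \<and> \<not> e1 \<and> \<not> e2 then quad_kernel rs pr qr ps qs pq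
         rs' pr' qr' ps' qs' pq' else 0) +
     (if e1 \<and> e2 \<and> e3 \<and> \<not> e4 then apex_kernel pq pr ps qr qs rs
         pq' pr' ps' qr' qs' rs' else 0) +
     (if e1 \<and> e2 \<and> e4 \<and> \<not> e3 then apex_kernel pq qr qs pr ps rs
         pq' qr' qs' pr' ps' rs' else 0) +
     (if e1 \<and> e3 \<and> e4 \<and> \<not> e2 then apex_kernel pr qr rs pq ps qs
         pr' qr' rs' pq' ps' qs' else 0) +
     (if e2 \<and> e3 \<and> e4 \<and> \<not> e1 then apex_kernel ps qs rs pq pr qr
         ps' qs' rs' pq' pr' qr' else 0)"

definition core_at :: "(nat \<Rightarrow> nat \<Rightarrow> nat \<Rightarrow> bool) \<Rightarrow> nat
  \<Rightarrow> nat \<Rightarrow> nat \<Rightarrow> nat \<Rightarrow> nat \<Rightarrow> nat \<Rightarrow>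
    int" where
  "core_at h p q r s u v = core (h p q r) (h p q s) (h p r s) (h q r s)
     (h p q u) (h p r u) (h p s u) (h q r u) (h q s u) (h r s u)
     (h p q v) (h p r v) (h p s v) (h q r v) (h q s v) (h r s v)"

definition pair_at :: "(nat \<Rightarrow> nat \<Rightarrow> nat \<Rightarrow> bool) \<Rightarrow> nat
  \<Rightarrow> nat \<Rightarrow> nat \<Rightarrow> nat \<Rightarrow> nat \<Rightarrow> nat \<Rightarrow>
    int" where
  "pair_at h p q r s u v = pair_kernel (h p q r) (h p q s) (h p r s) (h q r s)
     (h p q u) (h p q v) (h p u v) (h q u v)"

definition triples :: "(nat \<times> nat \<times> nat) list" where
  "triples = [(0, 1, 2), (0, 1, 3), (0, 1, 4), (0, 1, 5), (0, 2, 3), (0, 2, 4), (0, 2, 5), (0, 3, 4), (0, 3,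
    5), (0, 4, 5), (1, 2, 3), (1, 2, 4), (1, 2, 5), (1, 3, 4), (1, 3, 5), (1, 4, 5), (2, 3, 4), (2, 3, 5),
      (2, 4, 5), (3, 4, 5)]"

text \<open>One representative of each orbit of the 720 labellings under the group of order 16
  generated by the exchanges in \<open>pair_at_swap\<close>: 15 pairs, each with three ways to split
  the other four vertices.\<close>

definition pair_splits :: "(nat \<times> nat \<times> nat \<times> nat \<times> nat \<times> nat) list" where
  "pair_splits = [
    (0, 1, 2, 3, 4, 5), (0, 1, 2, 4, 3, 5), (0, 1, 2, 5, 3, 4), (0, 2, 1, 3, 4, 5), (0, 2, 1, 4, 3, 5),
    (0, 2, 1, 5, 3, 4), (0, 3, 1, 2, 4, 5), (0, 3, 1, 4, 2, 5), (0, 3, 1, 5, 2, 4), (0, 4, 1, 2, 3, 5),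
    (0, 4, 1, 3, 2, 5), (0, 4, 1, 5, 2, 3), (0, 5, 1, 2, 3, 4), (0, 5, 1, 3, 2, 4), (0, 5, 1, 4, 2, 3),
    (1, 2, 0, 3, 4, 5), (1, 2, 0, 4, 3, 5), (1, 2, 0, 5, 3, 4), (1, 3, 0, 2, 4, 5), (1, 3, 0, 4, 2, 5),
    (1, 3, 0, 5, 2, 4), (1, 4, 0, 2, 3, 5), (1, 4, 0, 3, 2, 5), (1, 4, 0, 5, 2, 3), (1, 5, 0, 2, 3, 4),
    (1, 5, 0, 3, 2, 4), (1, 5, 0, 4, 2, 3), (2, 3, 0, 1, 4, 5), (2, 3, 0, 4, 1, 5), (2, 3, 0, 5, 1, 4),
    (2, 4, 0, 1, 3, 5), (2, 4, 0, 3, 1, 5), (2, 4, 0, 5, 1, 3), (2, 5, 0, 1, 3, 4), (2, 5, 0, 3, 1, 4),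
    (2, 5, 0, 4, 1, 3), (3, 4, 0, 1, 2, 5), (3, 4, 0, 2, 1, 5), (3, 4, 0, 5, 1, 2), (3, 5, 0, 1, 2, 4),
    (3, 5, 0, 2, 1, 4), (3, 5, 0, 4, 1, 2), (4, 5, 0, 1, 2, 3), (4, 5, 0, 2, 1, 3), (4, 5, 0, 3, 1, 2)]"

text \<open>One representative of each orbit under the 48 permutations that preserve a set of four
  vertices and its complement.\<close>

definition quad_splits :: "(nat \<times> nat \<times> nat \<times> nat \<times> nat \<times> nat) list" where
  "quad_splits = [
    (0, 1, 2, 3, 4, 5), (0, 1, 2, 4, 3, 5), (0, 1, 2, 5, 3, 4), (0, 1, 3, 4, 2, 5), (0, 1, 3, 5, 2, 4),
    (0, 1, 4, 5, 2, 3), (0, 2, 3, 4, 1, 5), (0, 2, 3, 5, 1, 4), (0, 2, 4, 5, 1, 3), (0, 3, 4, 5, 1, 2),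
    (1, 2, 3, 4, 0, 5), (1, 2, 3, 5, 0, 4), (1, 2, 4, 5, 0, 3), (1, 3, 4, 5, 0, 2), (2, 3, 4, 5, 0, 1)]"

text \<open>Up to a common factor, \<open>3/8\<close> minus the edge density of a 3-graph on six vertices minus the average of all
  the products of two forms that the graph carries. Summed over all maps of six points into a graph these
  products become squares, so it suffices that the deficit of every admissible 3-graph is nonnegative.\<close>

definition deficit :: "(nat \<Rightarrow> nat \<Rightarrow> nat \<Rightarrow> bool) \<Rightarrow> int" where
  "deficit h = 232190115840 - 30958682112 * (\<Sum>(p, q, r)\<leftarrow>triples. of_bool (h p q r))
     - (\<Sum>(p, q, r, s, u, v)\<leftarrow>pair_splits. pair_at h p q r s u v)
     - (\<Sum>(p, q, r, s, u, v)\<leftarrow>quad_splits. core_at h p q r s u v)"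

section \<open>Nonnegativity of the averaged products\<close>

lemma tuple_sum_add:
  "tuple_sum V (\<lambda>a b c d y z. F a b c d y z + G a b c d y z) = tuple_sum V F + tuple_sum V G"
  by (simp add: tuple_sum_def sum.distrib)

lemma tuple_sum_cmult:
  "tuple_sum V (\<lambda>a b c d y z. k * F a b c d y z) = k * tuple_sum V F"
  by (simp add: tuple_sum_def sum_distrib_left)

text \<open>Every list entry contributes c times a square, the linear form being \<open>t\<close>
  times the entry of \<open>v\<close> at the index. The factor \<open>t\<close> is 1 for the even
  forms and \<open>twist\<close> for the odd ones.\<close>

lemma tuple_sum_quad_form_nonneg:
  assumes "\<forall>(c, v)\<in>set S. 0 \<le> c"
  shows "0 \<le> tuple_sum V (\<lambda>a b c d y z. if s a b c d
    then t a b c d y * t a b c d z * quad_form S (i a b c d y) (i a b c d z) else 0)"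
  using assms
proof (induction S)
  case Nil
  then show ?case by (simp add: quad_form_def tuple_sum_def cong: if_cong)
next
  case (Cons cv S)
  obtain c v where cv: "cv = (c, v)" by fastforce
  have "(\<lambda>a b c d y z. if s a b c d
      then t a b c d y * t a b c d z * quad_form (cv # S) (i a b c d y) (i a b c d z) else 0)
    = (\<lambda>a b ca d y z.
      c * (if s a b ca d then (t a b ca d y * v ! i a b ca d y) * (t a b ca d z * v ! i a b ca d z) else 0)
      + (if s a b ca d then t a b ca d y * t a b ca d z * quad_form S (i a b ca d y) (i a b ca d z) else 0))"
    by (intro ext) (simp add: quad_form_def cv algebra_simps)
  then show ?case
    using Cons cv by (simp add: tuple_sum_add tuple_sum_cmult tuple_sum_square_nonneg[of _ s "\<lambda>a b c
      d y. t a b c d y * v ! i a b c d y"])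
qed

lemma tuple_sum_pair_quad_form_nonneg:
  assumes "\<forall>(c, v)\<in>set S. 0 \<le> c"
  shows "0 \<le> tuple_sum V (\<lambda>a b c d y z.
    t a b c d * t a b y z * quad_form S (i a b c d) (i a b y z))"
  using assms
proof (induction S)
  case Nil
  then show ?case by (simp add: quad_form_def tuple_sum_def)
next
  case (Cons cv S)
  obtain c v where cv: "cv = (c, v)" by fastforce
  have "(\<lambda>a b c d y z. t a b c d * t a b y z * quad_form (cv # S) (i a b c d) (i a b y z))
    = (\<lambda>a b ca d y z. c * ((t a b ca d * v ! i a b ca d) * (t a b y z * v ! i a b y z))
      + t a b ca d * t a b y z * quad_form S (i a b ca d) (i a b y z))"
    by (intro ext) (simp add: quad_form_def cv algebra_simps)
  then show ?case
    using Cons cv by (simp add: tuple_sum_add tuple_sum_cmult tuple_sum_pair_square_nonneg[of _ "\<lambda>a b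
      c d. t a b c d * v ! i a b c d"])
qed

text \<open>The six predicates are arbitrary because every summand of \<open>core\<close> permutes
  the root differently. What matters is that the two halves of the argument list are the same
  functions of y and of z.\<close>

lemma tuple_sum_quad_kernel_nonneg:
  "0 \<le> tuple_sum V (\<lambda>a b c d y z. if s a b c d
    then quad_kernel (x1 a b c d y) (x2 a b c d y) (x3 a b c d y) (x4 a b c d y) (x5 a b c d y) (x6 a b c d y)
      (x1 a b c d z) (x2 a b c d z) (x3 a b c d z) (x4 a b c d z) (x5 a b c d z) (x6 a b c d z) else 0)"
proof -
  let ?i = "\<lambda>a b c d y. quad_index (x1 a b c d y) (x2 a b c d y) (x3 a b c d y) (x4 a b c d y) (x5 a
    b c d y) (x6 a b c d y)"
  let ?t = "\<lambda>a b c d y. twist (x2 a b c d y) (x3 a b c d y) (x4 a b c d y) (x5 a b c d y)"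
  have "0 \<le> tuple_sum V (\<lambda>a b c d y z. if s a b c d
      then 1 * 1 * quad_form quad_even (?i a b c d y) (?i a b c d z) else 0)
    + tuple_sum V (\<lambda>a b c d y z. if s a b c d
      then ?t a b c d y * ?t a b c d z * quad_form quad_odd (?i a b c d y) (?i a b c d z) else 0)"
    by (intro add_nonneg_nonneg tuple_sum_quad_form_nonneg) (simp_all add: quad_even_def quad_odd_def)
  also have "\<dots> = tuple_sum V (\<lambda>a b c d y z. if s a b c d
    then quad_kernel (x1 a b c d y) (x2 a b c d y) (x3 a b c d y) (x4 a b c d y) (x5 a b c d y) (x6 a b c d y)
      (x1 a b c d z) (x2 a b c d z) (x3 a b c d z) (x4 a b c d z) (x5 a b c d z) (x6 a b c d z) else 0)"
    unfolding tuple_sum_add[symmetric] quad_kernel_def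
    by (rule arg_cong[where f = "tuple_sum V"]) (auto simp: fun_eq_iff)
  finally show ?thesis .
qed

lemma tuple_sum_apex_kernel_nonneg:
  "0 \<le> tuple_sum V (\<lambda>a b c d y z. if s a b c d
    then apex_kernel (x1 a b c d y) (x2 a b c d y) (x3 a b c d y) (x4 a b c d y) (x5 a b c d y) (x6 a b c d y)
      (x1 a b c d z) (x2 a b c d z) (x3 a b c d z) (x4 a b c d z) (x5 a b c d z) (x6 a b c d z) else 0)"
proof -
  let ?t = "\<lambda>a b c d y. apex (x1 a b c d y) (x2 a b c d y) (x3 a b c d y) (x4 a b c d y) (x5 a b c d
    y) (x6 a b c d y)"
  have "0 \<le> apex_weight * tuple_sum V (\<lambda>a b c d y z. if s a b c d then ?t a b c d y * ?t a b c d
    z else 0)"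
    by (intro mult_nonneg_nonneg tuple_sum_square_nonneg) (simp add: apex_weight_def)
  then show ?thesis
    unfolding tuple_sum_cmult[symmetric] apex_kernel_def by (simp add: if_distrib cong: if_cong)
qed

lemma tuple_sum_core_nonneg:
  "0 \<le> tuple_sum V (\<lambda>a b c d y z. core (e a b c) (e a b d) (e a c d) (e b c d)
    (e a b y) (e a c y) (e a d y) (e b c y) (e b d y) (e c d y)
    (e a b z) (e a c z) (e a d z) (e b c z) (e b d z) (e c d z))"
  unfolding core_def tuple_sum_add
  by (intro add_nonneg_nonneg tuple_sum_quad_kernel_nonneg tuple_sum_apex_kernel_nonneg)

lemma tuple_sum_pair_kernel_nonneg:
  "0 \<le> tuple_sum V (\<lambda>a b c d y z. pair_kernel (e a b c) (e a b d) (e a c d) (e b c d)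
    (e a b y) (e a b z) (e a y z) (e b y z))"
proof -
  let ?i = "\<lambda>a b c d. pair_index (e a b c) (e a b d) (e a c d) (e b c d)"
  let ?j = "\<lambda>a b c d. of_bool (e a b c) + of_bool (e a b d) :: nat"
  let ?t = "\<lambda>a b c d. of_bool (e a c d) - of_bool (e b c d) :: int"
  have "0 \<le> tuple_sum V (\<lambda>a b c d y z. 1 * 1 * quad_form pair_even (?i a b c d) (?i a b y z))
    + tuple_sum V (\<lambda>a b c d y z. ?t a b c d * ?t a b y z * quad_form pair_odd (?j a b c d) (?j a b y
      z))"
    by (intro add_nonneg_nonneg tuple_sum_pair_quad_form_nonneg[where t = "\<lambda>_ _ _ _. 1"]
        tuple_sum_pair_quad_form_nonneg) (simp_all add: pair_even_def pair_odd_def)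
  then show ?thesis
    unfolding tuple_sum_add[symmetric] pair_kernel_def by simp
qed

section \<open>Invariance under relabelling\<close>

lemma quad_form_commute: "quad_form S i j = quad_form S j i"
  unfolding quad_form_def by (intro arg_cong[where f = sum_list] map_cong) auto

lemma quad_index_swap:
  "quad_index ab bc bd ac ad cd = quad_index ab ac ad bc bd cd"
  "quad_index ab ad ac bd bc cd = quad_index ab ac ad bc bd cd"
  by (cases ac; cases ad; cases bc; cases bd; simp add: quad_index_def shape_def)+

lemma twist_swap:
  "twist bc bd ac ad = - twist ac ad bc bd"
  "twist ad ac bd bc = - twist ac ad bc bd"
  by (cases ac; cases ad; cases bc; cases bd; simp add: twist_def)+

lemma quad_kernel_swap:
  "quad_kernel ab bc bd ac ad cd ab' bc' bd' ac' ad' cd' =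
    quad_kernel ab ac ad bc bd cd ab' ac' ad' bc' bd' cd'"
  "quad_kernel ab ad ac bd bc cd ab' ad' ac' bd' bc' cd' =
    quad_kernel ab ac ad bc bd cd ab' ac' ad' bc' bd' cd'"
  unfolding quad_kernel_def
  by (simp_all add: quad_index_swap(1)[of ab bc bd ac ad cd] quad_index_swap(1)[of ab' bc' bd' ac' ad' cd']
      quad_index_swap(2)[of ab ad ac bd bc cd] quad_index_swap(2)[of ab' ad' ac' bd' bc' cd']
      twist_swap(1)[of bc bd ac ad] twist_swap(1)[of bc' bd' ac' ad']
      twist_swap(2)[of ad ac bd bc] twist_swap(2)[of ad' ac' bd' bc'])

lemma quad_kernel_commute:
  "quad_kernel ab' ac' ad' bc' bd' cd' ab ac ad bc bd cd =
    quad_kernel ab ac ad bc bd cd ab' ac' ad' bc' bd' cd'"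
  unfolding quad_kernel_def by (simp add: quad_form_commute)

lemma apex_swap:
  "apex ac ab ad bc cd bd = apex ab ac ad bc bd cd"
  "apex ab ad ac bd bc cd = apex ab ac ad bc bd cd"
  by (auto simp: apex_def)

lemma apex_kernel_swap:
  "apex_kernel ac ab ad bc cd bd ac' ab' ad' bc' cd' bd' =
    apex_kernel ab ac ad bc bd cd ab' ac' ad' bc' bd' cd'"
  "apex_kernel ab ad ac bd bc cd ab' ad' ac' bd' bc' cd' =
    apex_kernel ab ac ad bc bd cd ab' ac' ad' bc' bd' cd'"
  unfolding apex_kernel_def
  by (simp_all only: apex_swap(1)[of ac ab ad bc cd bd] apex_swap(1)[of ac' ab' ad' bc' cd' bd']
      apex_swap(2)[of ab ad ac bd bc cd] apex_swap(2)[of ab' ad' ac' bd' bc' cd'])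

lemma apex_kernel_commute:
  "apex_kernel ab' ac' ad' bc' bd' cd' ab ac ad bc bd cd =
    apex_kernel ab ac ad bc bd cd ab' ac' ad' bc' bd' cd'"
  unfolding apex_kernel_def by simp

text \<open>With these sixteen cases neither the symmetry proofs nor the evaluation in the search
  ever expands the ten summands of \<open>core\<close>.\<close>

lemma core_table:
  "core True True True True pq pr ps qr qs rs pq' pr' ps' qr' qs' rs' = 0"
  "core True True True False pq pr ps qr qs rs pq' pr' ps' qr' qs' rs' = apex_kernel pq pr ps qr qs rs pq'
    pr' ps' qr' qs' rs'"
  "core True True False True pq pr ps qr qs rs pq' pr' ps' qr' qs' rs' = apex_kernel pq qr qs pr ps rs pq'
    qr' qs' pr' ps' rs'"
  "core True True False False pq pr ps qr qs rs pq' pr' ps' qr' qs' rs' = quad_kernel pq pr ps qr qs rs pq'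
    pr' ps' qr' qs' rs'"
  "core True False True True pq pr ps qr qs rs pq' pr' ps' qr' qs' rs' = apex_kernel pr qr rs pq ps qs pr'
    qr' rs' pq' ps' qs'"
  "core True False True False pq pr ps qr qs rs pq' pr' ps' qr' qs' rs' = quad_kernel pr pq ps qr rs qs pr'
    pq' ps' qr' rs' qs'"
  "core True False False True pq pr ps qr qs rs pq' pr' ps' qr' qs' rs' = quad_kernel qr pq qs pr rs ps qr'
    pq' qs' pr' rs' ps'"
  "core True False False False pq pr ps qr qs rs pq' pr' ps' qr' qs' rs' = 0"
  "core False True True True pq pr ps qr qs rs pq' pr' ps' qr' qs' rs' = apex_kernel ps qs rs pq pr qr ps'
    qs' rs' pq' pr' qr'"
  "core False True True False pq pr ps qr qs rs pq' pr' ps' qr' qs' rs' = quad_kernel ps pq pr qs rs qr ps'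
    pq' pr' qs' rs' qr'"
  "core False True False True pq pr ps qr qs rs pq' pr' ps' qr' qs' rs' = quad_kernel qs pq qr ps rs pr qs'
    pq' qr' ps' rs' pr'"
  "core False True False False pq pr ps qr qs rs pq' pr' ps' qr' qs' rs' = 0"
  "core False False True True pq pr ps qr qs rs pq' pr' ps' qr' qs' rs' = quad_kernel rs pr qr ps qs pq rs'
    pr' qr' ps' qs' pq'"
  "core False False True False pq pr ps qr qs rs pq' pr' ps' qr' qs' rs' = 0"
  "core False False False True pq pr ps qr qs rs pq' pr' ps' qr' qs' rs' = 0"
  "core False False False False pq pr ps qr qs rs pq' pr' ps' qr' qs' rs' = 0"
  by (simp_all add: core_def)

text \<open>The adjacent exchanges of p and q, q and r, r and s generate all permutations of the
  quadruple. Together with \<open>core_commute\<close> they give the 48 symmetries behind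
  \<open>quad_splits\<close>.\<close>

lemma core_swap_pq:
  "core e1 e2 e4 e3 pq qr qs pr ps rs pq' qr' qs' pr' ps' rs' =
    core e1 e2 e3 e4 pq pr ps qr qs rs pq' pr' ps' qr' qs' rs'"
  by (cases e1; cases e2; cases e3; cases e4;
      simp add: core_table quad_kernel_swap apex_kernel_swap)

lemma core_swap_qr:
  "core e1 e3 e2 e4 pr pq ps qr rs qs pr' pq' ps' qr' rs' qs' =
    core e1 e2 e3 e4 pq pr ps qr qs rs pq' pr' ps' qr' qs' rs'"
  by (cases e1; cases e2; cases e3; cases e4;
      simp add: core_table quad_kernel_swap apex_kernel_swap)

lemma core_swap_rs:
  "core e2 e1 e3 e4 pq ps pr qs qr rs pq' ps' pr' qs' qr' rs' =
    core e1 e2 e3 e4 pq pr ps qr qs rs pq' pr' ps' qr' qs' rs'"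
  by (cases e1; cases e2; cases e3; cases e4;
      simp add: core_table quad_kernel_swap apex_kernel_swap)

lemma core_commute:
  "core e1 e2 e3 e4 pq' pr' ps' qr' qs' rs' pq pr ps qr qs rs =
    core e1 e2 e3 e4 pq pr ps qr qs rs pq' pr' ps' qr' qs' rs'"
  by (cases e1; cases e2; cases e3; cases e4;
      simp add: core_table quad_kernel_commute apex_kernel_commute)

definition symmetric3 :: "('a \<Rightarrow> 'a \<Rightarrow> 'a \<Rightarrow> bool) \<Rightarrow> bool" where
  "symmetric3 h \<longleftrightarrow> (\<forall>x y z. h x y z = h y x z \<and> h x y z = h x z y)"

lemma core_at_swap:
  assumes "symmetric3 h"
  shows "core_at h q p r s u v = core_at h p q r s u v"
    and "core_at h p r q s u v = core_at h p q r s u v"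
    and "core_at h p q s r u v = core_at h p q r s u v"
    and "core_at h p q r s v u = core_at h p q r s u v"
proof -
  have s: "h y x z = h x y z" "h x z y = h x y z" for x y z
    using assms unfolding symmetric3_def by blast+
  have "core_at h q p r s u v = core (h p q r) (h p q s) (h q r s) (h p r s)
     (h p q u) (h q r u) (h q s u) (h p r u) (h p s u) (h r s u)
     (h p q v) (h q r v) (h q s v) (h p r v) (h p s v) (h r s v)"
    unfolding core_at_def s(1)[of q p] ..
  then show "core_at h q p r s u v = core_at h p q r s u v"
    unfolding core_at_def by (rule trans) (rule core_swap_pq)
  have "core_at h p r q s u v = core (h p q r) (h p r s) (h p q s) (h q r s)
     (h p r u) (h p q u) (h p s u) (h q r u) (h r s u) (h q s u)
     (h p r v) (h p q v) (h p s v) (h q r v) (h r s v) (h q s v)"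
    unfolding core_at_def s(1)[of r q] s(2)[of p r q] ..
  then show "core_at h p r q s u v = core_at h p q r s u v"
    unfolding core_at_def by (rule trans) (rule core_swap_qr)
  have "core_at h p q s r u v = core (h p q s) (h p q r) (h p r s) (h q r s)
     (h p q u) (h p s u) (h p r u) (h q s u) (h q r u) (h r s u)
     (h p q v) (h p s v) (h p r v) (h q s v) (h q r v) (h r s v)"
    unfolding core_at_def s(1)[of s r] s(2)[of p s r] s(2)[of q s r] ..
  then show "core_at h p q s r u v = core_at h p q r s u v"
    unfolding core_at_def by (rule trans) (rule core_swap_rs)
  show "core_at h p q r s v u = core_at h p q r s u v"
    unfolding core_at_def by (rule core_commute)
qed

lemma pair_index_swap:
  "pair_index y x z w = pair_index x y z w"
  "pair_index x y w z = pair_index x y z w"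
  by (simp_all add: pair_index_def)

lemma pair_at_swap:
  assumes "symmetric3 h"
  shows "pair_at h q p r s u v = pair_at h p q r s u v"
    and "pair_at h p q s r u v = pair_at h p q r s u v"
    and "pair_at h p q r s v u = pair_at h p q r s u v"
    and "pair_at h p q u v r s = pair_at h p q r s u v"
proof -
  have s: "h y x z = h x y z" "h x z y = h x y z" for x y z
    using assms unfolding symmetric3_def by blast+
  show "pair_at h q p r s u v = pair_at h p q r s u v"
    unfolding pair_at_def pair_kernel_def s(1)[of q p]
    by (simp add: pair_index_swap(2)[of _ _ "h q r s"] pair_index_swap(2)[of _ _ "h q u v"] algebra_simps)
  show "pair_at h p q s r u v = pair_at h p q r s u v"
    unfolding pair_at_def pair_kernel_def s(2)[of _ s r]
    by (simp add: pair_index_swap(1)[of "h p q s"] add.commute)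
  show "pair_at h p q r s v u = pair_at h p q r s u v"
    unfolding pair_at_def pair_kernel_def s(2)[of _ v u]
    by (simp add: pair_index_swap(1)[of "h p q v"] add.commute)
  show "pair_at h p q u v r s = pair_at h p q r s u v"
    unfolding pair_at_def pair_kernel_def by (simp add: quad_form_commute mult.commute)
qed

text \<open>A transposition only permutes the summands of the three sums. The exchange rules, used
  as ordered rewriting, bring the arguments of every summand into a canonical order; after that both
  sides agree up to the order of summation.\<close>

lemma deficit_transpose:
  assumes h: "symmetric3 h" and "a < 6" "b < 6"
  shows "deficit (\<lambda>i j k. h (transpose a b i) (transpose a b j) (transpose a b k)) = deficit h"
proof -
  have s: "h y x z = h x y z" "h x z y = h x y z" for x y z
    using h unfolding symmetric3_def by blast+
  have c: "core_at (\<lambda>i j k. h (f i) (f j) (f k)) p q r s u v = core_at h (f p) (f q) (f r) (f s) (f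
    u) (f v)"
    for f p q r s u v by (simp add: core_at_def)
  have d: "pair_at (\<lambda>i j k. h (f i) (f j) (f k)) p q r s u v = pair_at h (f p) (f q) (f r) (f s) (f
    u) (f v)"
    for f p q r s u v by (simp add: pair_at_def)
  note num = transpose_def if_True if_False refl zero_neq_numeral numeral_neq_zero zero_neq_one one_neq_zero
    numeral_eq_iff numeral_eq_one_iff one_eq_numeral_iff num.distinct num.inject simp_thms
  note expand = list.map sum_list.Cons sum_list.Nil prod.case
  let ?S = "set [(0, 1), (0, 2), (0, 3), (0, 4), (0, 5), (1, 2), (1, 3), (1, 4), (1, 5),
      (2, 3), (2, 4), (2, 5), (3, 4), (3, 5), (4, 5)] :: (nat \<times> nat) set"
  have "deficit (\<lambda>i j k. h (transpose a b i) (transpose a b j) (transpose a b k)) = deficit h"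
    if "(a, b) \<in> ?S" for a b :: nat
    using that unfolding deficit_def triples_def pair_splits_def quad_splits_def c[of "transpose a b"] d[of
      "transpose a b"] list.set
    by (elim insertE emptyE; simp only: prod.inject; simp only: expand num;
        simp only: pair_at_swap[OF h] core_at_swap[OF h] s; simp only: add_ac)
  moreover have "transpose a b = transpose b a" by (rule transpose_commute)
  moreover have "(a, b) \<in> ?S \<or> (b, a) \<in> ?S \<or> a = b"
  proof -
    have "a = 0 \<or> a = 1 \<or> a = 2 \<or> a = 3 \<or> a = 4 \<or> a = 5"
      and "b = 0 \<or> b = 1 \<or> b = 2 \<or> b = 3 \<or> b = 4 \<or> b = 5"
      using assms(2,3) by linarith+
    then show ?thesis by (elim disjE; simp)
  qed
  moreover have "deficit (\<lambda>i j k. h (transpose a a i) (transpose a a j) (transpose a a k)) = deficit h"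
    by simp
  ultimately show ?thesis by metis
qed

section \<open>Nonnegativity of the deficit\<close>

text \<open>The Booleans are ordered by the largest vertex: four triples inside 0, 1, 2, 3, then six
  with largest vertex 4, then ten with 5. The search follows this order, so after ten decisions the
  graph on 0, ..., 4 is complete and can be tested for being sorted.\<close>

definition deficit20 :: "bool \<Rightarrow> bool \<Rightarrow> bool \<Rightarrow> bool \<Rightarrow> bool
  \<Rightarrow> bool \<Rightarrow> bool \<Rightarrow> bool \<Rightarrow> bool \<Rightarrow> bool
    \<Rightarrow> bool \<Rightarrow> bool \<Rightarrow> bool \<Rightarrow> bool \<Rightarrow> bool
      \<Rightarrow> bool \<Rightarrow> bool \<Rightarrow> bool \<Rightarrow> bool \<Rightarrow> bool
        \<Rightarrow> int" where
  "deficit20 b012 b013 b023 b123 b014 b024 b034 b124 b134 b234 b015 b025 b035 b045 b125 b135 b145 b235 b245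
    b345 =
     232190115840 - 30958682112 * (of_bool b012 + of_bool b013 + of_bool b014 + of_bool b015 + of_bool b023 +
       of_bool b024 + of_bool b025 + of_bool b034 + of_bool b035 + of_bool b045 + of_bool b123 + of_bool b124
         + of_bool b125 + of_bool b134 + of_bool b135 + of_bool b145 + of_bool b234 + of_bool b235 + of_bool
           b245 + of_bool b345)
     - (pair_kernel b012 b013 b023 b123 b014 b015 b045 b145 +
        pair_kernel b012 b014 b024 b124 b013 b015 b035 b135 +
        pair_kernel b012 b015 b025 b125 b013 b014 b034 b134 +
        pair_kernel b012 b023 b013 b123 b024 b025 b045 b245 +
        pair_kernel b012 b024 b014 b124 b023 b025 b035 b235 +
        pair_kernel b012 b025 b015 b125 b023 b024 b034 b234 +
        pair_kernel b013 b023 b012 b123 b034 b035 b045 b345 +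
        pair_kernel b013 b034 b014 b134 b023 b035 b025 b235 +
        pair_kernel b013 b035 b015 b135 b023 b034 b024 b234 +
        pair_kernel b014 b024 b012 b124 b034 b045 b035 b345 +
        pair_kernel b014 b034 b013 b134 b024 b045 b025 b245 +
        pair_kernel b014 b045 b015 b145 b024 b034 b023 b234 +
        pair_kernel b015 b025 b012 b125 b035 b045 b034 b345 +
        pair_kernel b015 b035 b013 b135 b025 b045 b024 b245 +
        pair_kernel b015 b045 b014 b145 b025 b035 b023 b235 +
        pair_kernel b012 b123 b013 b023 b124 b125 b145 b245 +
        pair_kernel b012 b124 b014 b024 b123 b125 b135 b235 +
        pair_kernel b012 b125 b015 b025 b123 b124 b134 b234 +
        pair_kernel b013 b123 b012 b023 b134 b135 b145 b345 +
        pair_kernel b013 b134 b014 b034 b123 b135 b125 b235 +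
        pair_kernel b013 b135 b015 b035 b123 b134 b124 b234 +
        pair_kernel b014 b124 b012 b024 b134 b145 b135 b345 +
        pair_kernel b014 b134 b013 b034 b124 b145 b125 b245 +
        pair_kernel b014 b145 b015 b045 b124 b134 b123 b234 +
        pair_kernel b015 b125 b012 b025 b135 b145 b134 b345 +
        pair_kernel b015 b135 b013 b035 b125 b145 b124 b245 +
        pair_kernel b015 b145 b014 b045 b125 b135 b123 b235 +
        pair_kernel b023 b123 b012 b013 b234 b235 b245 b345 +
        pair_kernel b023 b234 b024 b034 b123 b235 b125 b135 +
        pair_kernel b023 b235 b025 b035 b123 b234 b124 b134 +
        pair_kernel b024 b124 b012 b014 b234 b245 b235 b345 +
        pair_kernel b024 b234 b023 b034 b124 b245 b125 b145 +
        pair_kernel b024 b245 b025 b045 b124 b234 b123 b134 +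
        pair_kernel b025 b125 b012 b015 b235 b245 b234 b345 +
        pair_kernel b025 b235 b023 b035 b125 b245 b124 b145 +
        pair_kernel b025 b245 b024 b045 b125 b235 b123 b135 +
        pair_kernel b034 b134 b013 b014 b234 b345 b235 b245 +
        pair_kernel b034 b234 b023 b024 b134 b345 b135 b145 +
        pair_kernel b034 b345 b035 b045 b134 b234 b123 b124 +
        pair_kernel b035 b135 b013 b015 b235 b345 b234 b245 +
        pair_kernel b035 b235 b023 b025 b135 b345 b134 b145 +
        pair_kernel b035 b345 b034 b045 b135 b235 b123 b125 +
        pair_kernel b045 b145 b014 b015 b245 b345 b234 b235 +
        pair_kernel b045 b245 b024 b025 b145 b345 b134 b135 +
        pair_kernel b045 b345 b034 b035 b145 b245 b124 b125)
     - (core b012 b013 b023 b123 b014 b024 b034 b124 b134 b234 b015 b025 b035 b125 b135 b235 +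
        core b012 b014 b024 b124 b013 b023 b034 b123 b134 b234 b015 b025 b045 b125 b145 b245 +
        core b012 b015 b025 b125 b013 b023 b035 b123 b135 b235 b014 b024 b045 b124 b145 b245 +
        core b013 b014 b034 b134 b012 b023 b024 b123 b124 b234 b015 b035 b045 b135 b145 b345 +
        core b013 b015 b035 b135 b012 b023 b025 b123 b125 b235 b014 b034 b045 b134 b145 b345 +
        core b014 b015 b045 b145 b012 b024 b025 b124 b125 b245 b013 b034 b035 b134 b135 b345 +
        core b023 b024 b034 b234 b012 b013 b014 b123 b124 b134 b025 b035 b045 b235 b245 b345 +
        core b023 b025 b035 b235 b012 b013 b015 b123 b125 b135 b024 b034 b045 b234 b245 b345 +
        core b024 b025 b045 b245 b012 b014 b015 b124 b125 b145 b023 b034 b035 b234 b235 b345 +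
        core b034 b035 b045 b345 b013 b014 b015 b134 b135 b145 b023 b024 b025 b234 b235 b245 +
        core b123 b124 b134 b234 b012 b013 b014 b023 b024 b034 b125 b135 b145 b235 b245 b345 +
        core b123 b125 b135 b235 b012 b013 b015 b023 b025 b035 b124 b134 b145 b234 b245 b345 +
        core b124 b125 b145 b245 b012 b014 b015 b024 b025 b045 b123 b134 b135 b234 b235 b345 +
        core b134 b135 b145 b345 b013 b014 b015 b034 b035 b045 b123 b124 b125 b234 b235 b245 +
        core b234 b235 b245 b345 b023 b024 b025 b034 b035 b045 b123 b124 b125 b134 b135 b145)"

text \<open>A depth-first search through the 3-graphs on six vertices. The arguments \<open>b012, b013, \<dots>\<close> say which triples are
  edges; \<open>check4\<close>, \<dots>, \<open>check20\<close> decide one triple after the other and cut off as soon as a copy of \<open>F\<^sub>3\<^sub>,\<^sub>2\<close>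
  appears. Symmetry is broken by requiring that vertex 5 has least degree, that 0, 1, 2, 3 span at least as many
  edges as any other four of the vertices 0, \<dots>, 4, and that no transposition of two of 0, 1, 2, 3
    increases
  \<open>rank10\<close>. The conditionals matter: they keep the simplifier from entering a branch that is cut off.\<close>

definition low_degree :: "bool \<Rightarrow> bool \<Rightarrow> bool \<Rightarrow> bool \<Rightarrow> bool
  \<Rightarrow> bool \<Rightarrow> bool \<Rightarrow> bool \<Rightarrow> bool \<Rightarrow> bool
    \<Rightarrow> bool \<Rightarrow> bool \<Rightarrow> bool \<Rightarrow> bool \<Rightarrow> bool
      \<Rightarrow> bool \<Rightarrow> bool \<Rightarrow> bool \<Rightarrow> bool \<Rightarrow> bool
        \<Rightarrow> bool" where
  "low_degree b012 b013 b023 b123 b014 b024 b034 b124 b134 b234 b015 b025 b035 b045 b125 b135 b145 b235 b245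
    b345 \<longleftrightarrow>
    of_bool b012 + of_bool b013 + of_bool b014 + of_bool b015 + of_bool b023 + of_bool b024 + of_bool b025 +
      of_bool b034 + of_bool b035 + of_bool b045 < (of_bool b015 + of_bool b025 + of_bool b035 + of_bool b045
        + of_bool b125 + of_bool b135 + of_bool b145 + of_bool b235 + of_bool b245 + of_bool b345 :: nat)
          \<or> of_bool b012 + of_bool b013 + of_bool b014 + of_bool b015 + of_bool b123 + of_bool b124 +
            of_bool b125 + of_bool b134 + of_bool b135 + of_bool b145 < (of_bool b015 + of_bool b025 +
            of_bool b035 + of_bool b045 + of_bool b125 + of_bool b135 + of_bool b145 + of_bool b235 + of_bool
            b245 + of_bool b345 :: nat) \<or> of_bool b012 + of_bool b023 + of_bool b024 + of_bool b025 +
            of_bool b123 + of_bool b124 + of_bool b125 + of_bool b234 + of_bool b235 + of_bool b245 <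
            (of_bool b015 + of_bool b025 + of_bool b035 + of_bool b045 + of_bool b125 + of_bool b135 +
            of_bool b145 + of_bool b235 + of_bool b245 + of_bool b345 :: nat) \<or> of_bool b013 + of_bool
            b023 + of_bool b034 + of_bool b035 + of_bool b123 + of_bool b134 + of_bool b135 + of_bool b234 +
            of_bool b235 + of_bool b345 < (of_bool b015 + of_bool b025 + of_bool b035 + of_bool b045 +
            of_bool b125 + of_bool b135 + of_bool b145 + of_bool b235 + of_bool b245 + of_bool b345 :: nat)
            \<or> of_bool b014 + of_bool b024 + of_bool b034 + of_bool b045 + of_bool b124 + of_bool b134 +
            of_bool b145 + of_bool b234 + of_bool b245 + of_bool b345 < (of_bool b015 + of_bool b025 +
            of_bool b035 + of_bool b045 + of_bool b125 + of_bool b135 + of_bool b145 + of_bool b235 + of_bool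
            b245 + of_bool b345 :: nat)"

text \<open>A graph with a complete link at z and an edge \<open>abc\<close> avoiding z contains
  \<open>F32\<close>: for a further vertex d use \<open>zda, zdb, zdc, abc\<close>. Hence at an
  \<open>F32\<close>-free leaf this test discards only relabellings of \<open>J5\<close>.\<close>

definition full_star :: "bool \<Rightarrow> bool \<Rightarrow> bool \<Rightarrow> bool \<Rightarrow> bool
  \<Rightarrow> bool \<Rightarrow> bool \<Rightarrow> bool \<Rightarrow> bool \<Rightarrow> bool
    \<Rightarrow> bool \<Rightarrow> bool \<Rightarrow> bool \<Rightarrow> bool \<Rightarrow> bool
      \<Rightarrow> bool \<Rightarrow> bool \<Rightarrow> bool \<Rightarrow> bool \<Rightarrow> bool
        \<Rightarrow> bool" where
  "full_star b012 b013 b023 b123 b014 b024 b034 b124 b134 b234 b015 b025 b035 b045 b125 b135 b145 b235 b245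
    b345 \<longleftrightarrow>
    (b012 \<and> b013 \<and> b014 \<and> b015 \<and> b023 \<and> b024 \<and> b025 \<and> b034 \<and> b035
      \<and> b045) \<or> (b012 \<and> b013 \<and> b014 \<and> b015 \<and> b123 \<and> b124 \<and> b125 \<and>
        b134 \<and> b135 \<and> b145) \<or> (b012 \<and> b023 \<and> b024 \<and> b025 \<and> b123 \<and> b124
          \<and> b125 \<and> b234 \<and> b235 \<and> b245) \<or> (b013 \<and> b023 \<and> b034 \<and> b035
            \<and> b123 \<and> b134 \<and> b135 \<and> b234 \<and> b235 \<and> b345) \<or> (b014 \<and> b024
            \<and> b034 \<and> b045 \<and> b124 \<and> b134 \<and> b145 \<and> b234 \<and> b245 \<and> b345)
            \<or> (b015 \<and> b025 \<and> b035 \<and> b045 \<and> b125 \<and> b135 \<and> b145 \<and> b235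
            \<and> b245 \<and> b345)"

definition check20 :: "bool \<Rightarrow> bool \<Rightarrow> bool \<Rightarrow> bool \<Rightarrow> bool
  \<Rightarrow> bool \<Rightarrow> bool \<Rightarrow> bool \<Rightarrow> bool \<Rightarrow> bool
    \<Rightarrow> bool \<Rightarrow> bool \<Rightarrow> bool \<Rightarrow> bool \<Rightarrow> bool
      \<Rightarrow> bool \<Rightarrow> bool \<Rightarrow> bool \<Rightarrow> bool \<Rightarrow> bool
        \<Rightarrow> bool" where
  "check20 b012 b013 b023 b123 b014 b024 b034 b124 b134 b234 b015 b025 b035 b045 b125 b135 b145 b235 b245 b345 =
    (if low_degree b012 b013 b023 b123 b014 b024 b034 b124 b134 b234 b015 b025 b035 b045 b125 b135 b145 b235
      b245 b345
     then True
     else if full_star b012 b013 b023 b123 b014 b024 b034 b124 b134 b234 b015 b025 b035 b045 b125 b135 b145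
       b235 b245 b345
     then True
     else 0 \<le> deficit20 b012 b013 b023 b123 b014 b024 b034 b124 b134 b234 b015 b025 b035 b045 b125 b135
       b145 b235 b245 b345)"

text \<open>The disjuncts are the copies of \<open>F32\<close> whose last triple in the search order
  is 345, given by their other three edges. All conflict lists together contain the 60 copies on six
  vertices: six choices of the omitted vertex times ten choices of the pair in three edges. A level
  without a list, such as that of 015 or 025, completes no copy.\<close>

definition conflict19 :: "bool \<Rightarrow> bool \<Rightarrow> bool \<Rightarrow> bool \<Rightarrow> bool
  \<Rightarrow> bool \<Rightarrow> bool \<Rightarrow> bool \<Rightarrow> bool \<Rightarrow> bool
    \<Rightarrow> bool \<Rightarrow> bool \<Rightarrow> bool \<Rightarrow> bool \<Rightarrow> bool
      \<Rightarrow> bool \<Rightarrow> bool \<Rightarrow> bool \<Rightarrow> bool \<Rightarrow> bool" where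
  "conflict19 b012 b013 b023 b123 b014 b024 b034 b124 b134 b234 b015 b025 b035 b045 b125 b135 b145 b235 b245
    \<longleftrightarrow>
    (b013 \<and> b014 \<and> b015) \<or> (b013 \<and> b045 \<and> b145) \<or> (b023 \<and> b024 \<and> b025)
      \<or> (b023 \<and> b045 \<and> b245) \<or> (b123 \<and> b124 \<and> b125) \<or> (b123 \<and> b145
        \<and> b245) \<or> (b014 \<and> b035 \<and> b135) \<or> (b024 \<and> b035 \<and> b235) \<or> (b034
          \<and> b134 \<and> b015) \<or> (b034 \<and> b234 \<and> b025) \<or> (b124 \<and> b135 \<and> b235)
            \<or> (b134 \<and> b234 \<and> b125)"

definition check19 :: "bool \<Rightarrow> bool \<Rightarrow> bool \<Rightarrow> bool \<Rightarrow> bool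
  \<Rightarrow> bool \<Rightarrow> bool \<Rightarrow> bool \<Rightarrow> bool \<Rightarrow> bool
    \<Rightarrow> bool \<Rightarrow> bool \<Rightarrow> bool \<Rightarrow> bool \<Rightarrow> bool
      \<Rightarrow> bool \<Rightarrow> bool \<Rightarrow> bool \<Rightarrow> bool \<Rightarrow> bool" where
  "check19 b012 b013 b023 b123 b014 b024 b034 b124 b134 b234 b015 b025 b035 b045 b125 b135 b145 b235 b245 =
    (check20 b012 b013 b023 b123 b014 b024 b034 b124 b134 b234 b015 b025 b035 b045 b125 b135 b145 b235 b245
      False \<and> (if conflict19 b012 b013 b023 b123 b014 b024 b034 b124 b134 b234 b015 b025 b035 b045 b125
        b135 b145 b235 b245 then True else check20 b012 b013 b023 b123 b014 b024 b034 b124 b134 b234 b015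
          b025 b035 b045 b125 b135 b145 b235 b245 True))"

definition conflict18 :: "bool \<Rightarrow> bool \<Rightarrow> bool \<Rightarrow> bool \<Rightarrow> bool
  \<Rightarrow> bool \<Rightarrow> bool \<Rightarrow> bool \<Rightarrow> bool \<Rightarrow> bool
    \<Rightarrow> bool \<Rightarrow> bool \<Rightarrow> bool \<Rightarrow> bool \<Rightarrow> bool
      \<Rightarrow> bool \<Rightarrow> bool \<Rightarrow> bool \<Rightarrow> bool" where
  "conflict18 b012 b013 b023 b123 b014 b024 b034 b124 b134 b234 b015 b025 b035 b045 b125 b135 b145 b235
    \<longleftrightarrow>
    (b012 \<and> b014 \<and> b015) \<or> (b012 \<and> b045 \<and> b145) \<or> (b023 \<and> b034 \<and> b035)
      \<or> (b123 \<and> b134 \<and> b135) \<or> (b014 \<and> b025 \<and> b125) \<or> (b024 \<and> b124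
        \<and> b015) \<or> (b024 \<and> b234 \<and> b035) \<or> (b034 \<and> b025 \<and> b235) \<or> (b124
          \<and> b234 \<and> b135) \<or> (b134 \<and> b125 \<and> b235)"

definition check18 :: "bool \<Rightarrow> bool \<Rightarrow> bool \<Rightarrow> bool \<Rightarrow> bool
  \<Rightarrow> bool \<Rightarrow> bool \<Rightarrow> bool \<Rightarrow> bool \<Rightarrow> bool
    \<Rightarrow> bool \<Rightarrow> bool \<Rightarrow> bool \<Rightarrow> bool \<Rightarrow> bool
      \<Rightarrow> bool \<Rightarrow> bool \<Rightarrow> bool \<Rightarrow> bool" where
  "check18 b012 b013 b023 b123 b014 b024 b034 b124 b134 b234 b015 b025 b035 b045 b125 b135 b145 b235 =
    (check19 b012 b013 b023 b123 b014 b024 b034 b124 b134 b234 b015 b025 b035 b045 b125 b135 b145 b235 False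
      \<and> (if conflict18 b012 b013 b023 b123 b014 b024 b034 b124 b134 b234 b015 b025 b035 b045 b125 b135
        b145 b235 then True else check19 b012 b013 b023 b123 b014 b024 b034 b124 b134 b234 b015 b025 b035
          b045 b125 b135 b145 b235 True))"

definition conflict17 :: "bool \<Rightarrow> bool \<Rightarrow> bool \<Rightarrow> bool \<Rightarrow> bool
  \<Rightarrow> bool \<Rightarrow> bool \<Rightarrow> bool \<Rightarrow> bool \<Rightarrow> bool
    \<Rightarrow> bool \<Rightarrow> bool \<Rightarrow> bool \<Rightarrow> bool \<Rightarrow> bool
      \<Rightarrow> bool \<Rightarrow> bool \<Rightarrow> bool" where
  "conflict17 b012 b013 b023 b123 b014 b024 b034 b124 b134 b234 b015 b025 b035 b045 b125 b135 b145
    \<longleftrightarrow>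
    (b012 \<and> b013 \<and> b015) \<or> (b012 \<and> b035 \<and> b135) \<or> (b013 \<and> b025 \<and> b125)
      \<or> (b023 \<and> b123 \<and> b015) \<or> (b023 \<and> b234 \<and> b045) \<or> (b123 \<and> b234
        \<and> b145) \<or> (b024 \<and> b034 \<and> b045) \<or> (b124 \<and> b134 \<and> b145)"

definition check17 :: "bool \<Rightarrow> bool \<Rightarrow> bool \<Rightarrow> bool \<Rightarrow> bool
  \<Rightarrow> bool \<Rightarrow> bool \<Rightarrow> bool \<Rightarrow> bool \<Rightarrow> bool
    \<Rightarrow> bool \<Rightarrow> bool \<Rightarrow> bool \<Rightarrow> bool \<Rightarrow> bool
      \<Rightarrow> bool \<Rightarrow> bool \<Rightarrow> bool" where
  "check17 b012 b013 b023 b123 b014 b024 b034 b124 b134 b234 b015 b025 b035 b045 b125 b135 b145 =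
    (check18 b012 b013 b023 b123 b014 b024 b034 b124 b134 b234 b015 b025 b035 b045 b125 b135 b145 False
      \<and> (if conflict17 b012 b013 b023 b123 b014 b024 b034 b124 b134 b234 b015 b025 b035 b045 b125 b135
        b145 then True else check18 b012 b013 b023 b123 b014 b024 b034 b124 b134 b234 b015 b025 b035 b045
          b125 b135 b145 True))"

definition conflict16 :: "bool \<Rightarrow> bool \<Rightarrow> bool \<Rightarrow> bool \<Rightarrow> bool
  \<Rightarrow> bool \<Rightarrow> bool \<Rightarrow> bool \<Rightarrow> bool \<Rightarrow> bool
    \<Rightarrow> bool \<Rightarrow> bool \<Rightarrow> bool \<Rightarrow> bool \<Rightarrow> bool
      \<Rightarrow> bool \<Rightarrow> bool" where
  "conflict16 b012 b013 b023 b123 b014 b024 b034 b124 b134 b234 b015 b025 b035 b045 b125 b135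
    \<longleftrightarrow>
    (b012 \<and> b024 \<and> b025) \<or> (b013 \<and> b034 \<and> b035) \<or> (b014 \<and> b124 \<and> b025)
      \<or> (b014 \<and> b134 \<and> b035) \<or> (b024 \<and> b015 \<and> b125) \<or> (b034 \<and> b015
        \<and> b135) \<or> (b234 \<and> b125 \<and> b135)"

definition check16 :: "bool \<Rightarrow> bool \<Rightarrow> bool \<Rightarrow> bool \<Rightarrow> bool
  \<Rightarrow> bool \<Rightarrow> bool \<Rightarrow> bool \<Rightarrow> bool \<Rightarrow> bool
    \<Rightarrow> bool \<Rightarrow> bool \<Rightarrow> bool \<Rightarrow> bool \<Rightarrow> bool
      \<Rightarrow> bool \<Rightarrow> bool" where
  "check16 b012 b013 b023 b123 b014 b024 b034 b124 b134 b234 b015 b025 b035 b045 b125 b135 =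
    (check17 b012 b013 b023 b123 b014 b024 b034 b124 b134 b234 b015 b025 b035 b045 b125 b135 False \<and> (if
      conflict16 b012 b013 b023 b123 b014 b024 b034 b124 b134 b234 b015 b025 b035 b045 b125 b135 then True
        else check17 b012 b013 b023 b123 b014 b024 b034 b124 b134 b234 b015 b025 b035 b045 b125 b135 True))"

definition conflict15 :: "bool \<Rightarrow> bool \<Rightarrow> bool \<Rightarrow> bool \<Rightarrow> bool
  \<Rightarrow> bool \<Rightarrow> bool \<Rightarrow> bool \<Rightarrow> bool \<Rightarrow> bool
    \<Rightarrow> bool \<Rightarrow> bool \<Rightarrow> bool \<Rightarrow> bool \<Rightarrow> bool
      \<Rightarrow> bool" where
  "conflict15 b012 b013 b023 b123 b014 b024 b034 b124 b134 b234 b015 b025 b035 b045 b125 \<longleftrightarrow>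
    (b012 \<and> b023 \<and> b025) \<or> (b013 \<and> b123 \<and> b025) \<or> (b013 \<and> b134 \<and> b045)
      \<or> (b023 \<and> b015 \<and> b125) \<or> (b014 \<and> b034 \<and> b045)"

definition check15 :: "bool \<Rightarrow> bool \<Rightarrow> bool \<Rightarrow> bool \<Rightarrow> bool
  \<Rightarrow> bool \<Rightarrow> bool \<Rightarrow> bool \<Rightarrow> bool \<Rightarrow> bool
    \<Rightarrow> bool \<Rightarrow> bool \<Rightarrow> bool \<Rightarrow> bool \<Rightarrow> bool
      \<Rightarrow> bool" where
  "check15 b012 b013 b023 b123 b014 b024 b034 b124 b134 b234 b015 b025 b035 b045 b125 =
    (check16 b012 b013 b023 b123 b014 b024 b034 b124 b134 b234 b015 b025 b035 b045 b125 False \<and> (if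
      conflict15 b012 b013 b023 b123 b014 b024 b034 b124 b134 b234 b015 b025 b035 b045 b125 then True else
        check16 b012 b013 b023 b123 b014 b024 b034 b124 b134 b234 b015 b025 b035 b045 b125 True))"

definition conflict14 :: "bool \<Rightarrow> bool \<Rightarrow> bool \<Rightarrow> bool \<Rightarrow> bool
  \<Rightarrow> bool \<Rightarrow> bool \<Rightarrow> bool \<Rightarrow> bool \<Rightarrow> bool
    \<Rightarrow> bool \<Rightarrow> bool \<Rightarrow> bool \<Rightarrow> bool \<Rightarrow> bool" where
  "conflict14 b012 b013 b023 b123 b014 b024 b034 b124 b134 b234 b015 b025 b035 b045 \<longleftrightarrow>
    (b012 \<and> b123 \<and> b035) \<or> (b012 \<and> b124 \<and> b045) \<or> (b013 \<and> b023 \<and> b035)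
      \<or> (b014 \<and> b024 \<and> b045)"

definition check14 :: "bool \<Rightarrow> bool \<Rightarrow> bool \<Rightarrow> bool \<Rightarrow> bool
  \<Rightarrow> bool \<Rightarrow> bool \<Rightarrow> bool \<Rightarrow> bool \<Rightarrow> bool
    \<Rightarrow> bool \<Rightarrow> bool \<Rightarrow> bool \<Rightarrow> bool \<Rightarrow> bool" where
  "check14 b012 b013 b023 b123 b014 b024 b034 b124 b134 b234 b015 b025 b035 b045 =
    (check15 b012 b013 b023 b123 b014 b024 b034 b124 b134 b234 b015 b025 b035 b045 False \<and> (if
      conflict14 b012 b013 b023 b123 b014 b024 b034 b124 b134 b234 b015 b025 b035 b045 then True else check15
        b012 b013 b023 b123 b014 b024 b034 b124 b134 b234 b015 b025 b035 b045 True))"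

definition conflict13 :: "bool \<Rightarrow> bool \<Rightarrow> bool \<Rightarrow> bool \<Rightarrow> bool
  \<Rightarrow> bool \<Rightarrow> bool \<Rightarrow> bool \<Rightarrow> bool \<Rightarrow> bool
    \<Rightarrow> bool \<Rightarrow> bool \<Rightarrow> bool \<Rightarrow> bool" where
  "conflict13 b012 b013 b023 b123 b014 b024 b034 b124 b134 b234 b015 b025 b035 \<longleftrightarrow>
    (b124 \<and> b015 \<and> b025) \<or> (b134 \<and> b015 \<and> b035) \<or> (b234 \<and> b025 \<and> b035)"

definition check13 :: "bool \<Rightarrow> bool \<Rightarrow> bool \<Rightarrow> bool \<Rightarrow> bool
  \<Rightarrow> bool \<Rightarrow> bool \<Rightarrow> bool \<Rightarrow> bool \<Rightarrow> bool
    \<Rightarrow> bool \<Rightarrow> bool \<Rightarrow> bool \<Rightarrow> bool" where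
  "check13 b012 b013 b023 b123 b014 b024 b034 b124 b134 b234 b015 b025 b035 =
    (check14 b012 b013 b023 b123 b014 b024 b034 b124 b134 b234 b015 b025 b035 False \<and> (if conflict13
      b012 b013 b023 b123 b014 b024 b034 b124 b134 b234 b015 b025 b035 then True else check14 b012 b013 b023
        b123 b014 b024 b034 b124 b134 b234 b015 b025 b035 True))"

definition conflict12 :: "bool \<Rightarrow> bool \<Rightarrow> bool \<Rightarrow> bool \<Rightarrow> bool
  \<Rightarrow> bool \<Rightarrow> bool \<Rightarrow> bool \<Rightarrow> bool \<Rightarrow> bool
    \<Rightarrow> bool \<Rightarrow> bool \<Rightarrow> bool" where
  "conflict12 b012 b013 b023 b123 b014 b024 b034 b124 b134 b234 b015 b025 \<longleftrightarrow>
    (b123 \<and> b015 \<and> b025)"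

definition check12 :: "bool \<Rightarrow> bool \<Rightarrow> bool \<Rightarrow> bool \<Rightarrow> bool
  \<Rightarrow> bool \<Rightarrow> bool \<Rightarrow> bool \<Rightarrow> bool \<Rightarrow> bool
    \<Rightarrow> bool \<Rightarrow> bool \<Rightarrow> bool" where
  "check12 b012 b013 b023 b123 b014 b024 b034 b124 b134 b234 b015 b025 =
    (check13 b012 b013 b023 b123 b014 b024 b034 b124 b134 b234 b015 b025 False \<and> (if conflict12 b012
      b013 b023 b123 b014 b024 b034 b124 b134 b234 b015 b025 then True else check13 b012 b013 b023 b123 b014
        b024 b034 b124 b134 b234 b015 b025 True))"

definition check11 :: "bool \<Rightarrow> bool \<Rightarrow> bool \<Rightarrow> bool \<Rightarrow> bool
  \<Rightarrow> bool \<Rightarrow> bool \<Rightarrow> bool \<Rightarrow> bool \<Rightarrow> bool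
    \<Rightarrow> bool \<Rightarrow> bool" where
  "check11 b012 b013 b023 b123 b014 b024 b034 b124 b134 b234 b015 =
    (check12 b012 b013 b023 b123 b014 b024 b034 b124 b134 b234 b015 False \<and> check12 b012 b013 b023 b123
      b014 b024 b034 b124 b134 b234 b015 True)"

text \<open>Read as a binary number, this is the lexicographic order on the ten values. The triples
  inside 0, 1, 2, 3 are the leading bits.\<close>

definition rank10 :: "bool \<Rightarrow> bool \<Rightarrow> bool \<Rightarrow> bool \<Rightarrow> bool
  \<Rightarrow> bool \<Rightarrow> bool \<Rightarrow> bool \<Rightarrow> bool \<Rightarrow> bool
    \<Rightarrow> nat" where
  "rank10 b012 b013 b023 b123 b014 b024 b034 b124 b134 b234 = 512 * of_bool b012 + 256 * of_bool b013 + 128 *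
    of_bool b023 + 64 * of_bool b123 + 32 * of_bool b014 + 16 * of_bool b024 + 8 * of_bool b034 + 4 * of_bool
      b124 + 2 * of_bool b134 + of_bool b234"

text \<open>The first four alternatives compare 0, 1, 2, 3 with the other quadruples in 0, ..., 4;
  the last six apply the transpositions (0 1), (0 2), (0 3), (1 2), (1 3), (2 3).\<close>

definition unsorted :: "bool \<Rightarrow> bool \<Rightarrow> bool \<Rightarrow> bool \<Rightarrow> bool
  \<Rightarrow> bool \<Rightarrow> bool \<Rightarrow> bool \<Rightarrow> bool \<Rightarrow> bool
    \<Rightarrow> bool" where
  "unsorted b012 b013 b023 b123 b014 b024 b034 b124 b134 b234 \<longleftrightarrow>
    (of_bool b012 + of_bool b014 + of_bool b024 + of_bool b124 > (of_bool b012 + of_bool b013 + of_bool b023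
      + of_bool b123 :: nat) \<or>
     of_bool b013 + of_bool b014 + of_bool b034 + of_bool b134 > (of_bool b012 + of_bool b013 + of_bool b023
       + of_bool b123 :: nat) \<or>
     of_bool b023 + of_bool b024 + of_bool b034 + of_bool b234 > (of_bool b012 + of_bool b013 + of_bool b023
       + of_bool b123 :: nat) \<or>
     of_bool b123 + of_bool b124 + of_bool b134 + of_bool b234 > (of_bool b012 + of_bool b013 + of_bool b023
       + of_bool b123 :: nat) \<or>
     rank10 b012 b013 b023 b123 b014 b024 b034 b124 b134 b234 < rank10 b012 b013 b123 b023 b014 b124 b134
       b024 b034 b234 \<or>
     rank10 b012 b013 b023 b123 b014 b024 b034 b124 b134 b234 < rank10 b012 b123 b023 b013 b124 b024 b234
       b014 b134 b034 \<or>
     rank10 b012 b013 b023 b123 b014 b024 b034 b124 b134 b234 < rank10 b123 b013 b023 b012 b134 b234 b034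
       b124 b014 b024 \<or>
     rank10 b012 b013 b023 b123 b014 b024 b034 b124 b134 b234 < rank10 b012 b023 b013 b123 b024 b014 b034
       b124 b234 b134 \<or>
     rank10 b012 b013 b023 b123 b014 b024 b034 b124 b134 b234 < rank10 b023 b013 b012 b123 b034 b024 b014
       b234 b134 b124 \<or>
     rank10 b012 b013 b023 b123 b014 b024 b034 b124 b134 b234 < rank10 b013 b012 b023 b123 b014 b034 b024
       b134 b124 b234)"

definition check10 :: "bool \<Rightarrow> bool \<Rightarrow> bool \<Rightarrow> bool \<Rightarrow> bool
  \<Rightarrow> bool \<Rightarrow> bool \<Rightarrow> bool \<Rightarrow> bool \<Rightarrow> bool
    \<Rightarrow> bool" where
  "check10 b012 b013 b023 b123 b014 b024 b034 b124 b134 b234 =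
    (if unsorted b012 b013 b023 b123 b014 b024 b034 b124 b134 b234 then True else (check11 b012 b013 b023
      b123 b014 b024 b034 b124 b134 b234 False \<and> check11 b012 b013 b023 b123 b014 b024 b034 b124 b134
        b234 True))"

definition conflict9 :: "bool \<Rightarrow> bool \<Rightarrow> bool \<Rightarrow> bool \<Rightarrow> bool
  \<Rightarrow> bool \<Rightarrow> bool \<Rightarrow> bool \<Rightarrow> bool \<Rightarrow> bool" where
  "conflict9 b012 b013 b023 b123 b014 b024 b034 b124 b134 \<longleftrightarrow>
    (b012 \<and> b013 \<and> b014) \<or> (b012 \<and> b034 \<and> b134) \<or> (b013 \<and> b024 \<and> b124)
      \<or> (b023 \<and> b123 \<and> b014)"

definition check9 :: "bool \<Rightarrow> bool \<Rightarrow> bool \<Rightarrow> bool \<Rightarrow> bool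
  \<Rightarrow> bool \<Rightarrow> bool \<Rightarrow> bool \<Rightarrow> bool \<Rightarrow> bool" where
  "check9 b012 b013 b023 b123 b014 b024 b034 b124 b134 =
    (check10 b012 b013 b023 b123 b014 b024 b034 b124 b134 False \<and> (if conflict9 b012 b013 b023 b123 b014
      b024 b034 b124 b134 then True else check10 b012 b013 b023 b123 b014 b024 b034 b124 b134 True))"

definition conflict8 :: "bool \<Rightarrow> bool \<Rightarrow> bool \<Rightarrow> bool \<Rightarrow> bool
  \<Rightarrow> bool \<Rightarrow> bool \<Rightarrow> bool \<Rightarrow> bool" where
  "conflict8 b012 b013 b023 b123 b014 b024 b034 b124 \<longleftrightarrow>
    (b012 \<and> b023 \<and> b024) \<or> (b013 \<and> b123 \<and> b024) \<or> (b023 \<and> b014 \<and> b124)"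

definition check8 :: "bool \<Rightarrow> bool \<Rightarrow> bool \<Rightarrow> bool \<Rightarrow> bool
  \<Rightarrow> bool \<Rightarrow> bool \<Rightarrow> bool \<Rightarrow> bool" where
  "check8 b012 b013 b023 b123 b014 b024 b034 b124 =
    (check9 b012 b013 b023 b123 b014 b024 b034 b124 False \<and> (if conflict8 b012 b013 b023 b123 b014 b024
      b034 b124 then True else check9 b012 b013 b023 b123 b014 b024 b034 b124 True))"

definition conflict7 :: "bool \<Rightarrow> bool \<Rightarrow> bool \<Rightarrow> bool \<Rightarrow> bool
  \<Rightarrow> bool \<Rightarrow> bool \<Rightarrow> bool" where
  "conflict7 b012 b013 b023 b123 b014 b024 b034 \<longleftrightarrow>
    (b012 \<and> b123 \<and> b034) \<or> (b013 \<and> b023 \<and> b034)"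

definition check7 :: "bool \<Rightarrow> bool \<Rightarrow> bool \<Rightarrow> bool \<Rightarrow> bool
  \<Rightarrow> bool \<Rightarrow> bool \<Rightarrow> bool" where
  "check7 b012 b013 b023 b123 b014 b024 b034 =
    (check8 b012 b013 b023 b123 b014 b024 b034 False \<and> (if conflict7 b012 b013 b023 b123 b014 b024 b034
      then True else check8 b012 b013 b023 b123 b014 b024 b034 True))"

definition conflict6 :: "bool \<Rightarrow> bool \<Rightarrow> bool \<Rightarrow> bool \<Rightarrow> bool
  \<Rightarrow> bool \<Rightarrow> bool" where
  "conflict6 b012 b013 b023 b123 b014 b024 \<longleftrightarrow>
    (b123 \<and> b014 \<and> b024)"

definition check6 :: "bool \<Rightarrow> bool \<Rightarrow> bool \<Rightarrow> bool \<Rightarrow> bool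
  \<Rightarrow> bool \<Rightarrow> bool" where
  "check6 b012 b013 b023 b123 b014 b024 =
    (check7 b012 b013 b023 b123 b014 b024 False \<and> (if conflict6 b012 b013 b023 b123 b014 b024 then True
      else check7 b012 b013 b023 b123 b014 b024 True))"

definition check5 :: "bool \<Rightarrow> bool \<Rightarrow> bool \<Rightarrow> bool \<Rightarrow> bool
  \<Rightarrow> bool" where
  "check5 b012 b013 b023 b123 b014 =
    (check6 b012 b013 b023 b123 b014 False \<and> check6 b012 b013 b023 b123 b014 True)"

definition check4 :: "bool \<Rightarrow> bool \<Rightarrow> bool \<Rightarrow> bool \<Rightarrow> bool" where
  "check4 b012 b013 b023 b123 =
    (check5 b012 b013 b023 b123 False \<and> check5 b012 b013 b023 b123 True)"

section \<open>Evaluation rules and soundness of the search\<close>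

lemma shape_table:
  "shape True True True True = 6"
  "shape True True True False = 5"
  "shape True True False True = 5"
  "shape True True False False = 2"
  "shape True False True True = 5"
  "shape True False True False = 3"
  "shape True False False True = 4"
  "shape True False False False = 1"
  "shape False True True True = 5"
  "shape False True True False = 4"
  "shape False True False True = 3"
  "shape False True False False = 1"
  "shape False False True True = 2"
  "shape False False True False = 1"
  "shape False False False True = 1"
  "shape False False False False = 0"
  by (simp_all add: shape_def)

lemma twist_table:
  "twist True True True True = 0"
  "twist True True True False = - 1"
  "twist True True False True = 1"
  "twist True True False False = 0"
  "twist True False True True = 1"
  "twist True False True False = 0"
  "twist True False False True = 1"
  "twist True False False False = 1"
  "twist False True True True = - 1"
  "twist False True True False = - 1"
  "twist False True False True = 0"
  "twist False True False False = - 1"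
  "twist False False True True = 0"
  "twist False False True False = - 1"
  "twist False False False True = 1"
  "twist False False False False = 0"
  by (simp_all add: twist_def)

lemma pair_index_table:
  "pair_index True True True True = 8"
  "pair_index True True True False = 5"
  "pair_index True True False True = 5"
  "pair_index True True False False = 2"
  "pair_index True False True True = 7"
  "pair_index True False True False = 4"
  "pair_index True False False True = 4"
  "pair_index True False False False = Suc 0"
  "pair_index False True True True = 7"
  "pair_index False True True False = 4"
  "pair_index False True False True = 4"
  "pair_index False True False False = Suc 0"
  "pair_index False False True True = 6"
  "pair_index False False True False = 3"
  "pair_index False False False True = 3"
  "pair_index False False False False = 0"
  by (simp_all add: pair_index_def)

lemmas check_defs = rank10_def low_degree_def full_star_def unsorted_def
  conflict19_def conflict18_def conflict17_def conflict16_def conflict15_def conflict14_def conflict13_def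
    conflict12_def conflict9_def conflict8_def conflict7_def conflict6_def
  check4_def check5_def check6_def check7_def check8_def check9_def check10_def check11_def check12_def
    check13_def check14_def check15_def check16_def check17_def check18_def check19_def check20_def

lemmas kernel_rules = deficit20_def core_table pair_kernel_def quad_kernel_def apex_kernel_def
  apex_weight_def quad_index_def
  shape_table twist_table pair_index_table apex_def pair_even_table pair_odd_table quad_even_table
    quad_odd_table

text \<open>A given graph follows a single path of the search tree. The hypotheses say that no
  cut-off lies on this path, so at each level the conjunct for the actual value of the next triple
  survives, down to the leaf.\<close>

lemma check_sound:
  assumes c4: "check4 b012 b013 b023 b123"
    and v19: "\<not> (b345 \<and> conflict19 b012 b013 b023 b123 b014 b024 b034 b124 b134 b234 b015 b025 b035
      b045 b125 b135 b145 b235 b245)"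
    and v18: "\<not> (b245 \<and> conflict18 b012 b013 b023 b123 b014 b024 b034 b124 b134 b234 b015 b025 b035
      b045 b125 b135 b145 b235)"
    and v17: "\<not> (b235 \<and> conflict17 b012 b013 b023 b123 b014 b024 b034 b124 b134 b234 b015 b025 b035
      b045 b125 b135 b145)"
    and v16: "\<not> (b145 \<and> conflict16 b012 b013 b023 b123 b014 b024 b034 b124 b134 b234 b015 b025 b035
      b045 b125 b135)"
    and v15: "\<not> (b135 \<and> conflict15 b012 b013 b023 b123 b014 b024 b034 b124 b134 b234 b015 b025 b035
      b045 b125)"
    and v14: "\<not> (b125 \<and> conflict14 b012 b013 b023 b123 b014 b024 b034 b124 b134 b234 b015 b025 b035
      b045)"
    and v13: "\<not> (b045 \<and> conflict13 b012 b013 b023 b123 b014 b024 b034 b124 b134 b234 b015 b025 b035)"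
    and v12: "\<not> (b035 \<and> conflict12 b012 b013 b023 b123 b014 b024 b034 b124 b134 b234 b015 b025)"
    and v9: "\<not> (b234 \<and> conflict9 b012 b013 b023 b123 b014 b024 b034 b124 b134)"
    and v8: "\<not> (b134 \<and> conflict8 b012 b013 b023 b123 b014 b024 b034 b124)"
    and v7: "\<not> (b124 \<and> conflict7 b012 b013 b023 b123 b014 b024 b034)"
    and v6: "\<not> (b034 \<and> conflict6 b012 b013 b023 b123 b014 b024)"
    and u: "\<not> unsorted b012 b013 b023 b123 b014 b024 b034 b124 b134 b234"
    and l: "\<not> low_degree b012 b013 b023 b123 b014 b024 b034 b124 b134 b234 b015 b025 b035 b045 b125 b135
      b145 b235 b245 b345"
    and f: "\<not> full_star b012 b013 b023 b123 b014 b024 b034 b124 b134 b234 b015 b025 b035 b045 b125 b135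
      b145 b235 b245 b345"
  shows "0 \<le> deficit20 b012 b013 b023 b123 b014 b024 b034 b124 b134 b234 b015 b025 b035 b045 b125 b135
    b145 b235 b245 b345"
proof -
  have c5: "check5 b012 b013 b023 b123 b014"
    using c4 unfolding check4_def by (cases b014) simp_all
  have c6: "check6 b012 b013 b023 b123 b014 b024"
    using c5 unfolding check5_def by (cases b024) simp_all
  have c7: "check7 b012 b013 b023 b123 b014 b024 b034"
    using c6 v6 unfolding check6_def by (cases b034) simp_all
  have c8: "check8 b012 b013 b023 b123 b014 b024 b034 b124"
    using c7 v7 unfolding check7_def by (cases b124) simp_all
  have c9: "check9 b012 b013 b023 b123 b014 b024 b034 b124 b134"
    using c8 v8 unfolding check8_def by (cases b134) simp_all
  have c10: "check10 b012 b013 b023 b123 b014 b024 b034 b124 b134 b234"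
    using c9 v9 unfolding check9_def by (cases b234) simp_all
  have c11: "check11 b012 b013 b023 b123 b014 b024 b034 b124 b134 b234 b015"
    using c10 u unfolding check10_def by (cases b015) simp_all
  have c12: "check12 b012 b013 b023 b123 b014 b024 b034 b124 b134 b234 b015 b025"
    using c11 unfolding check11_def by (cases b025) simp_all
  have c13: "check13 b012 b013 b023 b123 b014 b024 b034 b124 b134 b234 b015 b025 b035"
    using c12 v12 unfolding check12_def by (cases b035) simp_all
  have c14: "check14 b012 b013 b023 b123 b014 b024 b034 b124 b134 b234 b015 b025 b035 b045"
    using c13 v13 unfolding check13_def by (cases b045) simp_all
  have c15: "check15 b012 b013 b023 b123 b014 b024 b034 b124 b134 b234 b015 b025 b035 b045 b125"
    using c14 v14 unfolding check14_def by (cases b125) simp_all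
  have c16: "check16 b012 b013 b023 b123 b014 b024 b034 b124 b134 b234 b015 b025 b035 b045 b125 b135"
    using c15 v15 unfolding check15_def by (cases b135) simp_all
  have c17: "check17 b012 b013 b023 b123 b014 b024 b034 b124 b134 b234 b015 b025 b035 b045 b125 b135 b145"
    using c16 v16 unfolding check16_def by (cases b145) simp_all
  have c18: "check18 b012 b013 b023 b123 b014 b024 b034 b124 b134 b234 b015 b025 b035 b045 b125 b135 b145 b235"
    using c17 v17 unfolding check17_def by (cases b235) simp_all
  have c19: "check19 b012 b013 b023 b123 b014 b024 b034 b124 b134 b234 b015 b025 b035 b045 b125 b135 b145
    b235 b245"
    using c18 v18 unfolding check18_def by (cases b245) simp_all
  have c20: "check20 b012 b013 b023 b123 b014 b024 b034 b124 b134 b234 b015 b025 b035 b045 b125 b135 b145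
    b235 b245 b345"
    using c19 v19 unfolding check19_def by (cases b345) simp_all
  show ?thesis using c20 l f unfolding check20_def by simp
qed

lemma deficit_eq_deficit20:
  assumes "symmetric3 g"
  shows "deficit g = deficit20 (g 0 1 2) (g 0 1 3) (g 0 2 3) (g 1 2 3) (g 0 1 4) (g 0 2 4) (g 0 3 4) (g 1 2
    4) (g 1 3 4) (g 2 3 4) (g 0 1 5) (g 0 2 5) (g 0 3 5) (g 0 4 5) (g 1 2 5) (g 1 3 5) (g 1 4 5) (g 2 3 5) (g
      2 4 5) (g 3 4 5)"
proof -
  have s: "g y x z = g x y z" "g x z y = g x y z" for x y z
    using assms unfolding symmetric3_def by blast+
  show ?thesis
    unfolding deficit_def triples_def pair_splits_def quad_splits_def deficit20_def
    by (simp only: list.map sum_list.Cons sum_list.Nil prod.case core_at_def pair_at_def s add.assoc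
      add_0_right)
qed

section \<open>Normal form under relabelling, and the finite search\<close>

definition relabel :: "(nat \<Rightarrow> nat \<Rightarrow> nat \<Rightarrow> bool) \<Rightarrow> (nat
  \<Rightarrow> nat) \<Rightarrow> nat \<Rightarrow> nat \<Rightarrow> nat \<Rightarrow> bool" where
  "relabel h p = (\<lambda>i j k. h (p i) (p j) (p k))"

lemma relabel_relabel: "relabel (relabel h p) q = relabel h (p \<circ> q)"
  by (simp add: relabel_def fun_eq_iff)

lemma symmetric3_relabel: "symmetric3 h \<Longrightarrow> symmetric3 (relabel h p)"
  by (simp add: symmetric3_def relabel_def)

text \<open>Transpositions generate all permutations. The graph is generalised in the induction
  because the hypothesis is applied to a graph already relabelled by a transposition.\<close>

lemma deficit_relabel:
  assumes "p permutes {..<6}"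
  shows "symmetric3 h \<Longrightarrow> deficit (relabel h p) = deficit h"
  using assms finite_lessThan[of "6 :: nat"]
proof (induction p arbitrary: h rule: permutes_induct)
  case id
  then show ?case by (simp add: relabel_def)
next
  case (swap a b p)
  have "deficit (relabel (relabel h (transpose a b)) p) = deficit (relabel h (transpose a b))"
    using swap by (simp add: symmetric3_relabel)
  also have "\<dots> = deficit h"
    unfolding relabel_def using swap by (intro deficit_transpose) auto
  finally show ?case unfolding relabel_relabel .
qed

definition degree5 :: "(nat \<Rightarrow> nat \<Rightarrow> nat \<Rightarrow> bool) \<Rightarrow> nat" where
  "degree5 g = of_bool (g 0 1 5) + of_bool (g 0 2 5) + of_bool (g 0 3 5) + of_bool (g 0 4 5) + of_bool (g 1 2
    5) + of_bool (g 1 3 5) + of_bool (g 1 4 5) + of_bool (g 2 3 5) + of_bool (g 2 4 5) + of_bool (g 3 4 5)"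

definition edges4 :: "(nat \<Rightarrow> nat \<Rightarrow> nat \<Rightarrow> bool) \<Rightarrow> nat" where
  "edges4 g = of_bool (g 0 1 2) + of_bool (g 0 1 3) + of_bool (g 0 2 3) + of_bool (g 1 2 3)"

definition rank :: "(nat \<Rightarrow> nat \<Rightarrow> nat \<Rightarrow> bool) \<Rightarrow> nat" where
  "rank g = rank10 (g 0 1 2) (g 0 1 3) (g 0 2 3) (g 1 2 3) (g 0 1 4) (g 0 2 4) (g 0 3 4) (g 1 2 4) (g 1 3 4)
    (g 2 3 4)"

text \<open>Three nested optimisations: least \<open>degree5\<close>, then greatest
  \<open>edges4\<close>, then greatest \<open>rank\<close>. They are compatible because permutations
  of 0, ..., 4 preserve \<open>degree5\<close> and those of 0, ..., 3 also preserve
  \<open>edges4\<close>, so each later comparison takes place among ties of the earlier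
  ones.\<close>

lemma obtain_sorted_relabelling:
  obtains p where "p permutes {..<6}"
    "\<And>q. q permutes {..<6} \<Longrightarrow> degree5 (relabel h p) \<le> degree5 (relabel (relabel h p) q)"
    "\<And>q. q permutes {..<6} \<Longrightarrow> degree5 (relabel (relabel h p) q) = degree5 (relabel h p)
      \<Longrightarrow>
      edges4 (relabel (relabel h p) q) \<le> edges4 (relabel h p)"
    "\<And>q. q permutes {..<6} \<Longrightarrow> degree5 (relabel (relabel h p) q) = degree5 (relabel h p)
      \<Longrightarrow>
      edges4 (relabel (relabel h p) q) = edges4 (relabel h p) \<Longrightarrow>
      rank (relabel (relabel h p) q) \<le> rank (relabel h p)"
proof -
  have le: "of_bool P \<le> (1 :: nat)" for P by simp
  \<comment> \<open>The strict bounds 5 and 2^10 guarantee that the two maxima exist.\<close>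
  have e4: "edges4 g < 5" for g
    unfolding edges4_def using le[of "g 0 1 2"] le[of "g 0 1 3"] le[of "g 0 2 3"] le[of "g 1 2 3"] by linarith
  have r: "rank g < 1024" for g
    unfolding rank_def rank10_def using le[of "g 0 1 2"] le[of "g 0 1 3"] le[of "g 0 2 3"] le[of "g 1 2 3"]
      le[of "g 0 1 4"] le[of "g 0 2 4"] le[of "g 0 3 4"] le[of "g 1 2 4"] le[of "g 1 3 4"] le[of "g 2 3 4"]
        by linarith
  let ?P = "\<lambda>p. p permutes {..<6::nat}"
  have "?P id" by (rule permutes_id)
  from ex_has_least_nat[of ?P, OF this, of "\<lambda>p. degree5 (relabel h p)"]
  obtain p1 where p1: "?P p1" "\<And>q. ?P q \<Longrightarrow> degree5 (relabel h p1) \<le> degree5 (relabel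
    h q)" by blast
  let ?P2 = "\<lambda>p. ?P p \<and> degree5 (relabel h p) = degree5 (relabel h p1)"
  have "?P2 p1" using p1 by blast
  then have "\<exists>p. ?P2 p \<and> (\<forall>q. ?P2 q \<longrightarrow> edges4 (relabel h q) \<le> edges4
    (relabel h p))"
    by (rule ex_has_greatest_nat[of ?P2 p1 "\<lambda>p. edges4 (relabel h p)" 5]) (use e4 in simp)
  then obtain p2 where p2: "?P2 p2" "\<And>q. ?P2 q \<Longrightarrow> edges4 (relabel h q) \<le> edges4
    (relabel h p2)"
    by blast
  let ?P3 = "\<lambda>p. ?P2 p \<and> edges4 (relabel h p) = edges4 (relabel h p2)"
  have "?P3 p2" using p2 by blast
  then have "\<exists>p. ?P3 p \<and> (\<forall>q. ?P3 q \<longrightarrow> rank (relabel h q) \<le> rank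
    (relabel h p))"
    by (rule ex_has_greatest_nat[of ?P3 p2 "\<lambda>p. rank (relabel h p)" 1024]) (use r in simp)
  then obtain p3 where p3: "?P3 p3" "\<And>q. ?P3 q \<Longrightarrow> rank (relabel h q) \<le> rank (relabel
    h p3)"
    by blast
  have c: "?P (p3 \<circ> q)" if "?P q" for q
    using that p3(1) by (blast intro: permutes_compose)
  show ?thesis
  proof (rule that[of p3])
    show "?P p3" using p3 by blast
    fix q assume q: "?P q"
    show "degree5 (relabel h p3) \<le> degree5 (relabel (relabel h p3) q)"
      unfolding relabel_relabel using p1(2)[OF c[OF q]] p3(1) by simp
    show "edges4 (relabel (relabel h p3) q) \<le> edges4 (relabel h p3)"
      if "degree5 (relabel (relabel h p3) q) = degree5 (relabel h p3)"
      using that p2(2)[of "p3 \<circ> q"] c[OF q] p3(1) unfolding relabel_relabel by simp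
    show "rank (relabel (relabel h p3) q) \<le> rank (relabel h p3)"
      if "degree5 (relabel (relabel h p3) q) = degree5 (relabel h p3)"
        "edges4 (relabel (relabel h p3) q) = edges4 (relabel h p3)"
      using that p3(2)[of "p3 \<circ> q"] c[OF q] p3(1) unfolding relabel_relabel by simp
  qed
qed

text \<open>The forbidden configurations are stated without distinctness, since \<open>h\<close>
  will come from a map of six points that may identify some of them. Passing to the sorted
  relabelling makes every cut-off of the search legitimate.\<close>

lemma deficit_nonneg:
  assumes sym: "symmetric3 h"
    and fr0: "\<And>a b c d f. \<not> (h a b c \<and> h a b d \<and> h a b f \<and> h c d f)"
    and star0: "\<And>z a b c d f. \<not> (h z a b \<and> h z a c \<and> h z a d \<and> h z a f \<and> h z b
      c \<and>
      h z b d \<and> h z b f \<and> h z c d \<and> h z c f \<and> h z d f)"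
    and check: "\<And>b012 b013 b023 b123. check4 b012 b013 b023 b123"
  shows "0 \<le> deficit h"
proof -
  obtain p where p: "p permutes {..<6}" and
    d: "\<And>q. q permutes {..<6} \<Longrightarrow> degree5 (relabel h p) \<le> degree5 (relabel (relabel h
      p) q)" and
    e: "\<And>q. q permutes {..<6} \<Longrightarrow> degree5 (relabel (relabel h p) q) = degree5 (relabel h
      p) \<Longrightarrow>
      edges4 (relabel (relabel h p) q) \<le> edges4 (relabel h p)" and
    r: "\<And>q. q permutes {..<6} \<Longrightarrow> degree5 (relabel (relabel h p) q) = degree5 (relabel h
      p) \<Longrightarrow>
      edges4 (relabel (relabel h p) q) = edges4 (relabel h p) \<Longrightarrow>
      rank (relabel (relabel h p) q) \<le> rank (relabel h p)"
    using obtain_sorted_relabelling[of h] by blast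
  define g where "g = relabel h p"
  have g: "symmetric3 g" unfolding g_def by (rule symmetric3_relabel[OF sym])
  have s: "g y x z = g x y z" "g x z y = g x y z" for x y z
    using g unfolding symmetric3_def by blast+
  have fr: "\<not> (g a b c \<and> g a b d \<and> g a b f \<and> g c d f)" for a b c d f
    unfolding g_def relabel_def by (rule fr0)
  have star: "\<not> (g z a b \<and> g z a c \<and> g z a d \<and> g z a f \<and> g z b c \<and>
      g z b d \<and> g z b f \<and> g z c d \<and> g z c f \<and> g z d f)" for z a b c d f
    unfolding g_def relabel_def by (rule star0)
  have perm: "transpose a b permutes {..<6::nat}" if "a < 6" "b < 6" for a b
    using that by (intro permutes_swap_id) auto
  have deg: "degree5 g \<le> degree5 (relabel g (transpose a b))" if "a < 6" "b < 6" for a b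
    using d[OF perm[OF that]] unfolding g_def .
  have deg_eq: "degree5 (relabel g (transpose a b)) = degree5 g"
    if "(a, b) \<in> {(0, 1), (0, 2), (0, 3), (0, 4), (1, 2), (1, 3), (1, 4), (2, 3), (2, 4), (3, 4)}" for a b
    using that unfolding degree5_def relabel_def by (elim insertE emptyE; simp add: transpose_def s)
  have edg_eq: "edges4 (relabel g (transpose a b)) = edges4 g"
    if "(a, b) \<in> {(0, 1), (0, 2), (0, 3), (1, 2), (1, 3), (2, 3)}" for a b
    using that unfolding edges4_def relabel_def by (elim insertE emptyE; simp add: transpose_def s)
  have edg: "edges4 (relabel g (transpose a 4)) \<le> edges4 g" if "a < 4" for a
  proof -
    have "(a, 4) \<in> {(0, 1), (0, 2), (0, 3), (0, 4), (1, 2), (1, 3), (1, 4), (2, 3), (2, 4), (3, 4 :: nat)}"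
      using that by auto
    from e[OF perm, of a 4, folded g_def, OF _ _ deg_eq[OF this]] that show ?thesis by simp
  qed
  have rk: "rank (relabel g (transpose a b)) \<le> rank g"
    if "(a, b) \<in> {(0, 1), (0, 2), (0, 3), (1, 2), (1, 3), (2, 3)}" for a b
  proof -
    have ab: "a < 6" "b < 6"
      "(a, b) \<in> {(0, 1), (0, 2), (0, 3), (0, 4), (1, 2), (1, 3), (1, 4), (2, 3), (2, 4), (3, 4)}"
      using that by auto
    show ?thesis
      by (rule r[OF perm[OF ab(1,2)], folded g_def, OF deg_eq[OF ab(3)] edg_eq[OF that]])
  qed
  \<comment> \<open>In this and the following steps there is one instance of \<open>fr\<close> for
    each disjunct of the conflict list, in the same order; its first two indices are the pair
    contained in three edges of the copy.\<close>
  have v19: "\<not> ((g 3 4 5) \<and> conflict19 (g 0 1 2) (g 0 1 3) (g 0 2 3) (g 1 2 3) (g 0 1 4) (g 0 2 4)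
    (g 0 3 4) (g 1 2 4) (g 1 3 4) (g 2 3 4) (g 0 1 5) (g 0 2 5) (g 0 3 5) (g 0 4 5) (g 1 2 5) (g 1 3 5) (g 1
      4 5) (g 2 3 5) (g 2 4 5))"
    unfolding conflict19_def using fr[of 0 1 3 4 5] fr[of 4 5 0 1 3] fr[of 0 2 3 4 5] fr[of 4 5 0 2 3] fr[of
      1 2 3 4 5] fr[of 4 5 1 2 3] fr[of 3 5 0 1 4] fr[of 3 5 0 2 4] fr[of 3 4 0 1 5] fr[of 3 4 0 2 5] fr[of 3
        5 1 2 4] fr[of 3 4 1 2 5]
    by (simp only: s) argo
  have v18: "\<not> ((g 2 4 5) \<and> conflict18 (g 0 1 2) (g 0 1 3) (g 0 2 3) (g 1 2 3) (g 0 1 4) (g 0 2 4)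
    (g 0 3 4) (g 1 2 4) (g 1 3 4) (g 2 3 4) (g 0 1 5) (g 0 2 5) (g 0 3 5) (g 0 4 5) (g 1 2 5) (g 1 3 5) (g 1
      4 5) (g 2 3 5))"
    unfolding conflict18_def using fr[of 0 1 2 4 5] fr[of 4 5 0 1 2] fr[of 0 3 2 4 5] fr[of 1 3 2 4 5] fr[of
      2 5 0 1 4] fr[of 2 4 0 1 5] fr[of 2 4 0 3 5] fr[of 2 5 0 3 4] fr[of 2 4 1 3 5] fr[of 2 5 1 3 4]
    by (simp only: s) argo
  have v17: "\<not> ((g 2 3 5) \<and> conflict17 (g 0 1 2) (g 0 1 3) (g 0 2 3) (g 1 2 3) (g 0 1 4) (g 0 2 4)
    (g 0 3 4) (g 1 2 4) (g 1 3 4) (g 2 3 4) (g 0 1 5) (g 0 2 5) (g 0 3 5) (g 0 4 5) (g 1 2 5) (g 1 3 5) (g 1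
      4 5))"
    unfolding conflict17_def using fr[of 0 1 2 3 5] fr[of 3 5 0 1 2] fr[of 2 5 0 1 3] fr[of 2 3 0 1 5] fr[of
      2 3 0 4 5] fr[of 2 3 1 4 5] fr[of 0 4 2 3 5] fr[of 1 4 2 3 5]
    by (simp only: s) argo
  have v16: "\<not> ((g 1 4 5) \<and> conflict16 (g 0 1 2) (g 0 1 3) (g 0 2 3) (g 1 2 3) (g 0 1 4) (g 0 2 4)
    (g 0 3 4) (g 1 2 4) (g 1 3 4) (g 2 3 4) (g 0 1 5) (g 0 2 5) (g 0 3 5) (g 0 4 5) (g 1 2 5) (g 1 3 5))"
    unfolding conflict16_def using fr[of 0 2 1 4 5] fr[of 0 3 1 4 5] fr[of 1 4 0 2 5] fr[of 1 4 0 3 5] fr[of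
      1 5 0 2 4] fr[of 1 5 0 3 4] fr[of 1 5 2 3 4]
    by (simp only: s) argo
  have v15: "\<not> ((g 1 3 5) \<and> conflict15 (g 0 1 2) (g 0 1 3) (g 0 2 3) (g 1 2 3) (g 0 1 4) (g 0 2 4)
    (g 0 3 4) (g 1 2 4) (g 1 3 4) (g 2 3 4) (g 0 1 5) (g 0 2 5) (g 0 3 5) (g 0 4 5) (g 1 2 5))"
    unfolding conflict15_def using fr[of 0 2 1 3 5] fr[of 1 3 0 2 5] fr[of 1 3 0 4 5] fr[of 1 5 0 2 3] fr[of
      0 4 1 3 5]
    by (simp only: s) argo
  have v14: "\<not> ((g 1 2 5) \<and> conflict14 (g 0 1 2) (g 0 1 3) (g 0 2 3) (g 1 2 3) (g 0 1 4) (g 0 2 4)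
    (g 0 3 4) (g 1 2 4) (g 1 3 4) (g 2 3 4) (g 0 1 5) (g 0 2 5) (g 0 3 5) (g 0 4 5))"
    unfolding conflict14_def using fr[of 1 2 0 3 5] fr[of 1 2 0 4 5] fr[of 0 3 1 2 5] fr[of 0 4 1 2 5]
    by (simp only: s) argo
  have v13: "\<not> ((g 0 4 5) \<and> conflict13 (g 0 1 2) (g 0 1 3) (g 0 2 3) (g 1 2 3) (g 0 1 4) (g 0 2 4)
    (g 0 3 4) (g 1 2 4) (g 1 3 4) (g 2 3 4) (g 0 1 5) (g 0 2 5) (g 0 3 5))"
    unfolding conflict13_def using fr[of 0 5 1 2 4] fr[of 0 5 1 3 4] fr[of 0 5 2 3 4]
    by (simp only: s) argo
  have v12: "\<not> ((g 0 3 5) \<and> conflict12 (g 0 1 2) (g 0 1 3) (g 0 2 3) (g 1 2 3) (g 0 1 4) (g 0 2 4)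
    (g 0 3 4) (g 1 2 4) (g 1 3 4) (g 2 3 4) (g 0 1 5) (g 0 2 5))"
    unfolding conflict12_def using fr[of 0 5 1 2 3]
    by (simp only: s) argo
  have v9: "\<not> ((g 2 3 4) \<and> conflict9 (g 0 1 2) (g 0 1 3) (g 0 2 3) (g 1 2 3) (g 0 1 4) (g 0 2 4) (g
    0 3 4) (g 1 2 4) (g 1 3 4))"
    unfolding conflict9_def using fr[of 0 1 2 3 4] fr[of 3 4 0 1 2] fr[of 2 4 0 1 3] fr[of 2 3 0 1 4]
    by (simp only: s) argo
  have v8: "\<not> ((g 1 3 4) \<and> conflict8 (g 0 1 2) (g 0 1 3) (g 0 2 3) (g 1 2 3) (g 0 1 4) (g 0 2 4) (g
    0 3 4) (g 1 2 4))"
    unfolding conflict8_def using fr[of 0 2 1 3 4] fr[of 1 3 0 2 4] fr[of 1 4 0 2 3]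
    by (simp only: s) argo
  have v7: "\<not> ((g 1 2 4) \<and> conflict7 (g 0 1 2) (g 0 1 3) (g 0 2 3) (g 1 2 3) (g 0 1 4) (g 0 2 4) (g
    0 3 4))"
    unfolding conflict7_def using fr[of 1 2 0 3 4] fr[of 0 3 1 2 4]
    by (simp only: s) argo
  have v6: "\<not> ((g 0 3 4) \<and> conflict6 (g 0 1 2) (g 0 1 3) (g 0 2 3) (g 1 2 3) (g 0 1 4) (g 0 2 4))"
    unfolding conflict6_def using fr[of 0 4 1 2 3]
    by (simp only: s) argo
  have u: "\<not> unsorted (g 0 1 2) (g 0 1 3) (g 0 2 3) (g 1 2 3) (g 0 1 4) (g 0 2 4) (g 0 3 4) (g 1 2 4) (g
    1 3 4) (g 2 3 4)"
    using edg[of 0] edg[of 1] edg[of 2] edg[of 3] rk[of 0 1] rk[of 0 2] rk[of 0 3] rk[of 1 2] rk[of 1 3]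
      rk[of 2 3]
    unfolding unsorted_def edges4_def rank_def relabel_def
    by (simp add: transpose_def s)
  have l: "\<not> low_degree (g 0 1 2) (g 0 1 3) (g 0 2 3) (g 1 2 3) (g 0 1 4) (g 0 2 4) (g 0 3 4) (g 1 2 4)
    (g 1 3 4) (g 2 3 4) (g 0 1 5) (g 0 2 5) (g 0 3 5) (g 0 4 5) (g 1 2 5) (g 1 3 5) (g 1 4 5) (g 2 3 5) (g 2
      4 5) (g 3 4 5)"
    using deg[of 0 5] deg[of 1 5] deg[of 2 5] deg[of 3 5] deg[of 4 5]
    unfolding low_degree_def degree5_def relabel_def
    by (simp add: transpose_def s)
  have f: "\<not> full_star (g 0 1 2) (g 0 1 3) (g 0 2 3) (g 1 2 3) (g 0 1 4) (g 0 2 4) (g 0 3 4) (g 1 2 4)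
    (g 1 3 4) (g 2 3 4) (g 0 1 5) (g 0 2 5) (g 0 3 5) (g 0 4 5) (g 1 2 5) (g 1 3 5) (g 1 4 5) (g 2 3 5) (g 2
      4 5) (g 3 4 5)"
    using star[of 0 1 2 3 4 5] star[of 1 0 2 3 4 5] star[of 2 0 1 3 4 5] star[of 3 0 1 2 4 5] star[of 4 0 1 2
      3 5] star[of 5 0 1 2 3 4]
    unfolding full_star_def by (simp only: s) argo
  have "0 \<le> deficit g"
    unfolding deficit_eq_deficit20[OF g]
    by (rule check_sound[OF check v19 v18 v17 v16 v15 v14 v13 v12 v9 v8 v7 v6 u l f])
  then show ?thesis
    unfolding g_def using deficit_relabel[OF p sym] by simp
qed

text \<open>Any two triples inside 0, 1, 2, 3 are interchanged, and the other two fixed, by the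
  transposition of the vertices they omit. Since these triples are the leading bits of
  \<open>rank10\<close>, every pattern with a False before a True is cut off by
  \<open>unsorted\<close>. There remains one pattern for each number of edges from 0 to 4.\<close>

lemma check4_unsorted:
  "check4 True True False True"
  "check4 True False True True"
  "check4 True False True False"
  "check4 True False False True"
  "check4 False True True True"
  "check4 False True True False"
  "check4 False True False True"
  "check4 False True False False"
  "check4 False False True True"
  "check4 False False True False"
  "check4 False False False True"
  by (simp_all add: check_defs kernel_rules)

text \<open>Every quadruple in 0, ..., 4 then spans no edge, so all edges contain 5; as 5 has least
  degree, only the empty graph is left. Its deficit is 232190115840 - 45 * 5159780352 = 0, as it
  must be for six points in one class of the blow-up.\<close>

lemma check4_0: "check4 False False False False"
  by (simp add: check_defs kernel_rules)

lemma check4_1: "check4 True False False False"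
  by (simp add: check_defs kernel_rules)

lemma check4_2: "check4 True True False False"
  by (simp add: check_defs kernel_rules)

lemma check4_3: "check4 True True True False"
  by (simp add: check_defs kernel_rules)

lemma check4_4: "check4 True True True True"
  by (simp add: check_defs kernel_rules)

lemma check4: "check4 b012 b013 b023 b123"
  by (cases b012; cases b013; cases b023; cases b123;
      simp only: check4_unsorted check4_0 check4_1 check4_2 check4_3 check4_4)

section \<open>The upper bound\<close>

lemma sum_sum_list_swap:
  fixes G :: "'b \<Rightarrow> 'c \<Rightarrow> int"
  shows "(\<Sum>f\<in>A. \<Sum>x\<leftarrow>xs. G f x) = (\<Sum>x\<leftarrow>xs. \<Sum>f\<in>A. G f x)"
  by (induction xs) (simp_all add: sum.distrib)

lemma tuple_set_eq:
  assumes "distinct xs" "length xs = n" "\<forall>x\<in>set xs. x < n"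
  shows "set xs = {..<n}"
  by (rule card_subset_eq) (use assms distinct_card[of xs] in auto)

lemma sum_pair_at_nonneg:
  assumes "distinct [p, q, r, s, u, v]" "\<forall>x\<in>set [p, q, r, s, u, v]. x < 6"
  shows "0 \<le> (\<Sum>f\<in>PiE {..<6} (\<lambda>_. V). pair_at (\<lambda>i j k. e (f i) (f j) (f k)) p q r
    s u v)"
  unfolding pair_at_def
  using tuple_sum_pair_kernel_nonneg[of V e]
    sum_tuples_permute[OF assms(1) tuple_set_eq[OF assms(1) _ assms(2)], where V = V and C = "\<lambda>a b c
      d y z.
      pair_kernel (e a b c) (e a b d) (e a c d) (e b c d) (e a b y) (e a b z) (e a y z) (e b y z)"]
  by simp

lemma sum_core_at_nonneg:
  assumes "distinct [p, q, r, s, u, v]" "\<forall>x\<in>set [p, q, r, s, u, v]. x < 6"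
  shows "0 \<le> (\<Sum>f\<in>PiE {..<6} (\<lambda>_. V). core_at (\<lambda>i j k. e (f i) (f j) (f k)) p q r
    s u v)"
  unfolding core_at_def
  using tuple_sum_core_nonneg[of V e]
    sum_tuples_permute[OF assms(1) tuple_set_eq[OF assms(1) _ assms(2)], where V = V and C = "\<lambda>a b c
      d y z.
      core (e a b c) (e a b d) (e a c d) (e b c d)
        (e a b y) (e a c y) (e a d y) (e b c y) (e b d y) (e c d y)
        (e a b z) (e a c z) (e a d z) (e b c z) (e b d z) (e c d z)"]
  by simp

lemma tuple_sum_triple:
  "tuple_sum V (\<lambda>a b c d y z. F a b c) = (int (card V)) ^ 3 * (\<Sum>a\<in>V. \<Sum>b\<in>V.
    \<Sum>c\<in>V. F a b c)"
proof -
  have "{..<4::nat} = {..<Suc (Suc (Suc (Suc 0)))}" by auto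
  then show ?thesis
    unfolding tuple_sum_expand
    by (simp only: sum_PiE_lessThan_Suc) (simp add: sum_distrib_left power3_eq_cube algebra_simps)
qed

lemma sum_triple_at:
  fixes F :: "'a \<Rightarrow> 'a \<Rightarrow> 'a \<Rightarrow> int"
  assumes "distinct [p, q, r]" "\<forall>x\<in>set [p, q, r]. x < (6::nat)"
  shows "(\<Sum>f\<in>PiE {..<6} (\<lambda>_. V). F (f p) (f q) (f r)) =
    (int (card V)) ^ 3 * (\<Sum>a\<in>V. \<Sum>b\<in>V. \<Sum>c\<in>V. F a b c)"
proof -
  \<comment> \<open>The three remaining indices complete p, q, r to a labelling of all six, so
    \<open>sum_tuples_permute\<close> applies; their coordinates are free and contribute the cube of
    the number of vertices.\<close>
  have "card ({..<6} - {p, q, r}) = 3"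
    using assms by (subst card_Diff_subset) auto
  then obtain s u v where s: "{..<6} - {p, q, r} = {s, u, v}" "s \<noteq> u" "u \<noteq> v" "s \<noteq> v"
    by (auto simp: card_3_iff)
  then have "s \<in> {..<6} - {p, q, r}" "u \<in> {..<6} - {p, q, r}" "v \<in> {..<6} - {p, q, r}" by blast+
  then have d: "distinct [p, q, r, s, u, v]" "\<forall>x\<in>set [p, q, r, s, u, v]. x < 6"
    using assms s(2-4) by auto
  show ?thesis
    using sum_tuples_permute[OF d(1) tuple_set_eq[OF d(1) _ d(2)], where V = V and C = "\<lambda>a b c _ _ _.
      F a b c"]
    by (simp add: tuple_sum_triple)
qed

lemma triple_density_le:
  fixes e :: "'a \<Rightarrow> 'a \<Rightarrow> 'a \<Rightarrow> bool"
  assumes V: "finite V"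
    and nonneg: "\<And>f. f \<in> PiE {..<6} (\<lambda>_. V) \<Longrightarrow> 0 \<le> deficit (\<lambda>i j
      k. e (f i) (f j) (f k))"
  shows "8 * (\<Sum>a\<in>V. \<Sum>b\<in>V. \<Sum>c\<in>V. of_bool (e a b c)) \<le> 3 * (int (card V)) ^ 3"
proof (cases "V = {}")
  case False
  let ?A = "PiE {..<6::nat} (\<lambda>_. V)"
  let ?h = "\<lambda>f i j k. e (f i) (f j) (f k)"
  let ?n = "int (card V)"
  let ?m = "\<Sum>a\<in>V. \<Sum>b\<in>V. \<Sum>c\<in>V. of_bool (e a b c) :: int"
  have P: "0 \<le> (\<Sum>(p, q, r, s, u, v)\<leftarrow>pair_splits. \<Sum>f\<in>?A. pair_at (?h f) p q r s u
    v)"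
    unfolding pair_splits_def
    by (simp only: list.map sum_list.Cons sum_list.Nil prod.case)
      (intro add_nonneg_nonneg sum_pair_at_nonneg; simp)
  have Q: "0 \<le> (\<Sum>(p, q, r, s, u, v)\<leftarrow>quad_splits. \<Sum>f\<in>?A. core_at (?h f) p q r s u
    v)"
    unfolding quad_splits_def
    by (simp only: list.map sum_list.Cons sum_list.Nil prod.case)
      (intro add_nonneg_nonneg sum_core_at_nonneg; simp)
  have T: "(\<Sum>(p, q, r)\<leftarrow>triples. \<Sum>f\<in>?A. of_bool (?h f p q r) :: int) = 20 * (?n ^ 3 *
    ?m)"
  proof -
    have "(\<Sum>(p, q, r)\<leftarrow>triples. \<Sum>f\<in>?A. of_bool (?h f p q r) :: int) = (\<Sum>(p, q,
      r)\<leftarrow>triples. ?n ^ 3 * ?m)"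
      by (intro arg_cong[where f = sum_list] map_cong refl)
        (auto simp: triples_def sum_triple_at[where F = "\<lambda>a b c. of_bool (e a b c)"])
    also have "\<dots> = 20 * (?n ^ 3 * ?m)"
      by (simp add: triples_def)
    finally show ?thesis .
  qed
  have "0 \<le> (\<Sum>f\<in>?A. deficit (?h f))"
    using nonneg by (rule sum_nonneg)
  also have "\<dots> = int (card ?A) * 232190115840
      - 30958682112 * (\<Sum>(p, q, r)\<leftarrow>triples. \<Sum>f\<in>?A. of_bool (?h f p q r))
      - (\<Sum>(p, q, r, s, u, v)\<leftarrow>pair_splits. \<Sum>f\<in>?A. pair_at (?h f) p q r s u v)
      - (\<Sum>(p, q, r, s, u, v)\<leftarrow>quad_splits. \<Sum>f\<in>?A. core_at (?h f) p q r s u v)"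
    unfolding deficit_def sum_subtractf sum_distrib_left[symmetric] sum_sum_list_swap
    by (simp add: case_prod_unfold sum_sum_list_swap)
  finally have "30958682112 * (20 * (?n ^ 3 * ?m)) \<le> int (card ?A) * 232190115840"
    using P Q unfolding T by linarith
  moreover have "int (card ?A) = ?n ^ 3 * ?n ^ 3"
    by (simp add: card_PiE power_add[symmetric])
  \<comment> \<open>Both coefficients are divided by 77396705280, that is 619173642240 / 8 and
    232190115840 / 3. Cancelling the remaining cube is the reason for treating the empty vertex set
    separately.\<close>
  ultimately have "?n ^ 3 * (8 * ?m) \<le> ?n ^ 3 * (3 * ?n ^ 3)"
    by (simp add: algebra_simps)
  moreover have "0 < ?n ^ 3" using V False by (simp add: card_gt_0_iff)
  ultimately show ?thesis by (simp only: mult_le_cancel_left_pos)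
qed simp

lemma card_triple_iff: "card {x, y, z} = 3 \<longleftrightarrow> x \<noteq> y \<and> x \<noteq> z \<and> y
  \<noteq> z"
  by (auto simp: card_insert_if)

text \<open>No distinctness has to be assumed: any two of the five vertices lie in one of the four
  triples, and each triple has three elements. This transfers freeness to arbitrary, also
  non-injective, maps of six points.\<close>

lemma F32_free_edges:
  assumes G: "three_graph G" and free: "family_free {J5, F32} G"
  shows "\<not> ({a, b, c} \<in> edges G \<and> {a, b, d} \<in> edges G \<and> {a, b, f} \<in> edges G \<and>
    {c, d, f} \<in> edges G)"
proof
  assume E: "{a, b, c} \<in> edges G \<and> {a, b, d} \<in> edges G \<and> {a, b, f} \<in> edges G \<and> {c,
    d, f} \<in> edges G"
  have ed: "e \<subseteq> verts G \<and> card e = 3" if "e \<in> edges G" for e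
    using G that unfolding three_graph_def by (rule bspec)
  have V: "{a, b, c} \<subseteq> verts G" "{a, b, d} \<subseteq> verts G" "{a, b, f} \<subseteq> verts G"
    by (rule conjunct1[OF ed], simp add: E)+
  have C: "card {a, b, c} = 3" "card {a, b, d} = 3" "card {a, b, f} = 3" "card {c, d, f} = 3"
    by (rule conjunct2[OF ed], simp add: E)+
  \<comment> \<open>The vertices of \<open>F32\<close> are numbered from 1 and list positions from
    0, whence the shift by one.\<close>
  define \<phi> where "\<phi> = (\<lambda>i. [a, b, c, d, f] ! (i - 1))"
  have \<phi>: "\<phi> 1 = a" "\<phi> 2 = b" "\<phi> 3 = c" "\<phi> 4 = d" "\<phi> 5 = f"
    by (simp_all add: \<phi>_def)
  have v: "verts F32 = {1, 2, 3, 4, 5}" unfolding F32_def by auto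
  have "distinct [a, b, c, d, f]"
    using C unfolding card_triple_iff by simp
  then have "inj_on ((!) [a, b, c, d, f] \<circ> (\<lambda>i. i - 1)) {1..5}"
    by (intro comp_inj_on inj_on_nth) (auto simp: inj_on_def)
  then have "inj_on \<phi> (verts F32)"
    unfolding \<phi>_def comp_def F32_def by simp
  moreover have "\<phi> ` verts F32 \<subseteq> verts G"
    using V unfolding v by (simp add: \<phi>[unfolded One_nat_def] \<phi>)
  moreover have "\<forall>e\<in>edges F32. \<phi> ` e \<in> edges G"
    using E unfolding F32_def by (simp add: \<phi>[unfolded One_nat_def] \<phi>)
  ultimately have "contains_copy G F32"
    unfolding contains_copy_def by blast
  then show False using free unfolding family_free_def by blast
qed

text \<open>As for \<open>F32\<close>, the ten edges force all six vertices to be distinct.\<close>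

lemma J5_free_edges:
  assumes G: "three_graph G" and free: "family_free {J5, F32} G"
  shows "\<not> ({z, a, b} \<in> edges G \<and> {z, a, c} \<in> edges G \<and> {z, a, d} \<in> edges G \<and>
    {z, a, f} \<in> edges G \<and>
    {z, b, c} \<in> edges G \<and> {z, b, d} \<in> edges G \<and> {z, b, f} \<in> edges G \<and> {z, c, d}
      \<in> edges G \<and>
    {z, c, f} \<in> edges G \<and> {z, d, f} \<in> edges G)"
proof
  assume E: "{z, a, b} \<in> edges G \<and> {z, a, c} \<in> edges G \<and> {z, a, d} \<in> edges G \<and> {z,
    a, f} \<in> edges G \<and>
    {z, b, c} \<in> edges G \<and> {z, b, d} \<in> edges G \<and> {z, b, f} \<in> edges G \<and> {z, c, d}
      \<in> edges G \<and>
    {z, c, f} \<in> edges G \<and> {z, d, f} \<in> edges G"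
  have ed: "e \<subseteq> verts G \<and> card e = 3" if "e \<in> edges G" for e
    using G that unfolding three_graph_def by (rule bspec)
  have V: "{z, a, b} \<subseteq> verts G" "{z, c, d} \<subseteq> verts G" "{z, d, f} \<subseteq> verts G"
    by (rule conjunct1[OF ed], simp add: E)+
  have C: "card {z, a, b} = 3" "card {z, a, c} = 3" "card {z, a, d} = 3" "card {z, a, f} = 3"
      "card {z, b, c} = 3" "card {z, b, d} = 3" "card {z, b, f} = 3" "card {z, c, d} = 3"
      "card {z, c, f} = 3" "card {z, d, f} = 3"
    by (rule conjunct2[OF ed], simp add: E)+
  \<comment> \<open>The centre z comes last because it is the image of the vertex 6.\<close>
  define \<phi> where "\<phi> = (\<lambda>i. [a, b, c, d, f, z] ! (i - 1))"
  have \<phi>: "\<phi> 1 = a" "\<phi> 2 = b" "\<phi> 3 = c" "\<phi> 4 = d" "\<phi> 5 = f" "\<phi> 6 = z"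
    by (simp_all add: \<phi>_def)
  have v: "verts J5 = {1, 2, 3, 4, 5, 6}" unfolding J5_def by auto
  have "distinct [a, b, c, d, f, z]"
    using C unfolding card_triple_iff by auto
  then have "inj_on ((!) [a, b, c, d, f, z] \<circ> (\<lambda>i. i - 1)) {1..6}"
    by (intro comp_inj_on inj_on_nth) (auto simp: inj_on_def)
  then have "inj_on \<phi> (verts J5)"
    unfolding \<phi>_def comp_def J5_def by simp
  moreover have "\<phi> ` verts J5 \<subseteq> verts G"
    using V unfolding v by (simp add: \<phi>[unfolded One_nat_def] \<phi>)
  moreover have "\<phi> ` e \<in> edges G" if "e \<in> edges J5" for e
  proof -
    have "\<exists>x y. e = {x, y, 6} \<and> {x, y} \<subseteq> {1..5} \<and> x \<noteq> y"
      using that unfolding J5_def by simp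
    then obtain x y where e: "e = {x, y, 6}" and xy: "{x, y} \<subseteq> {1..5}" "x \<noteq> y"
      by blast
    have s: "x \<in> {1, 2, 3, 4, 5}" "y \<in> {1, 2, 3, 4, 5}" using xy(1) by auto
    have "{z, \<phi> x, \<phi> y} \<in> edges G"
      using s xy(2) E by (auto simp: \<phi>[unfolded One_nat_def] \<phi> insert_commute)
    moreover have "\<phi> ` e = {z, \<phi> x, \<phi> y}"
      unfolding e by (auto simp: \<phi>)
    ultimately show ?thesis by simp
  qed
  ultimately have "contains_copy G J5"
    unfolding contains_copy_def by blast
  then show False using free unfolding family_free_def by blast
qed

lemma sum_of_bool_triples:
  assumes "finite V" and "\<And>a b c. e a b c \<Longrightarrow> a \<in> V \<and> b \<in> V \<and> c \<in> V"
  shows "(\<Sum>a\<in>V. \<Sum>b\<in>V. \<Sum>c\<in>V. of_bool (e a b c)) = int (card {(a, b, c). e a b c})"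
proof -
  have eq: "{(a, b, c). e a b c} = (V \<times> V \<times> V) \<inter> {t. case t of (a, b, c) \<Rightarrow> e
    a b c}"
    by (auto dest: assms(2))
  have "int (card {(a, b, c). e a b c}) = (\<Sum>t\<in>V \<times> V \<times> V. of_bool (case t of (a, b, c)
    \<Rightarrow> e a b c))"
    by (subst eq) (simp add: assms(1) sum_of_bool_eq)
  also have "\<dots> = (\<Sum>a\<in>V. \<Sum>b\<in>V. \<Sum>c\<in>V. of_bool (e a b c))"
    by (simp add: sum.cartesian_product case_prod_unfold)
  finally show ?thesis ..
qed

lemma edges_le:
  fixes G :: "'a hypergraph"
  assumes G: "three_graph G" "finite (verts G)" and free: "family_free {J5, F32} G"
  shows "16 * card (edges G) \<le> card (verts G) ^ 3"
proof -
  let ?V = "verts G"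
  let ?e = "\<lambda>x y z. {x, y, z} \<in> edges G"
  let ?T = "{(x, y, z). {x, y, z} \<in> edges G}"
  have "8 * (\<Sum>a\<in>?V. \<Sum>b\<in>?V. \<Sum>c\<in>?V. of_bool (?e a b c)) \<le> 3 * (int (card ?V)) ^ 3"
  proof (rule triple_density_le[OF G(2)])
    fix f :: "nat \<Rightarrow> 'a"
    show "0 \<le> deficit (\<lambda>i j k. ?e (f i) (f j) (f k))"
    proof (rule deficit_nonneg)
      show "symmetric3 (\<lambda>i j k. ?e (f i) (f j) (f k))"
        unfolding symmetric3_def by (simp add: insert_commute)
    qed (rule F32_free_edges[OF G(1) free] J5_free_edges[OF G(1) free] check4)+
  qed
  also have "(\<Sum>a\<in>?V. \<Sum>b\<in>?V. \<Sum>c\<in>?V. of_bool (?e a b c)) = int (card ?T)"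
  proof (rule sum_of_bool_triples[OF G(2)])
    fix a b c assume "?e a b c"
    then have "{a, b, c} \<subseteq> ?V \<and> card {a, b, c} = 3"
      using G(1) unfolding three_graph_def by (rule bspec[rotated])
    then show "a \<in> ?V \<and> b \<in> ?V \<and> c \<in> ?V" by simp
  qed
  also have "card ?T = 6 * card (edges G)"
    using three_graph_card_edges_le(1)[OF G] G(1)
    by (intro card_ordered_triples) (auto simp: three_graph_def)
  finally have "16 * int (card (edges G)) \<le> int (card ?V) ^ 3" by simp
  then have "int (16 * card (edges G)) \<le> int (card ?V ^ 3)"
    by (simp only: of_nat_mult of_nat_power of_nat_numeral)
  then show ?thesis
    by (simp only: of_nat_le_iff)
qed

theorem theorem6:
  shows "turan_density {J5, F32} = 3 / 8"
  using turan_density_J5_F32_ge turan_density_J5_F32_le[OF edges_le] by (simp add: order.antisym)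

end
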